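(* For $k\in(0,2)$ let $z_k$ be the librational brake orbit of energy $k$ and minimal period $T_k$ of the planar pendulum $H(p,q)=\frac12p^2+(1-\cos q)$. Then $$\iota^T(z_k)=1,\qquad \iota^E(z_k)=2,\qquad \iota_D(z_k)=1 .$$ In particular, librational brake orbits are not minimizers for the fixed-time or free-time variational problems.
   Context: The pendulum has configuration space $\mathbb R$, equations $\dot p=-\sin q$, $\dot q=p$, and Lagrangian $L(q,\dot q)=\frac12\dot q^2-(1-\cos q)$. For $k\in(0,2)$ set $a_k=\arccos(1-k)\in(0,\pi)$; $z_k(t)=(p_k(t),q_k(t))$ is the (librational) periodic solution on $\{H=k\}$ with $z_k(0)=(0,a_k)$, and $T_k$ is its minimal period. It satisfies $q_k(-t)=q_k(t)$, $p_k(-t)=-p_k(t)$. With $T=T_k$ and $\gamma=q_k$: $\mathcal A^T(q)=\int_0^T L(q,\dot q)\,dt$. $\iota^T(z_k)$ is the maximal dimension of a subspace of $T$-periodic $H^1$ variations on which $d^2\mathcal A^T(\gamma)$ is negative definite; $\iota_D(z_k)$ is the same with $H^1$ variations on $[0,T]$ vanishing at $t=0$ and $t=T$. Free-period functional: $\mathcal S_k(x,T)=T\int_0^1[L(x(s),x'(s)/T)+k]\,ds$ on $H^1(\mathbb R/\mathbb Z,\mathbb R)\times(0,+\infty)$; $\iota^E(z_k)$ is the maximal dimension of a subspace of $H^1(\mathbb R/\mathbb Z,\mathbb R)\times\mathbb R$ on which $d^2\mathcal S_k(x,T)$, at $x(s)=\gamma(Ts)$, is negative definite. The fixed-time and free-time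 variational problems are those of $\mathcal A^T$ (on $T$-periodic loops) and $\mathcal S_k$. *)

theory Defs
  imports "HOL-Analysis.Analysis" "HOL-Library.Function_Algebras" "HOL-Library.Extended_Nat"
begin

text \<open>Pointwise vector space structure on functions, so that \<open>subspace\<close>, \<open>span\<close> and \<open>dim\<close>
  apply to spaces of variations.\<close>

instantiation "fun" :: (type, real_vector) real_vector
begin

definition scaleR_fun :: "real \<Rightarrow> ('a \<Rightarrow> 'b) \<Rightarrow> 'a \<Rightarrow> 'b"
  where "scaleR_fun c f = (\<lambda>x. c *\<^sub>R f x)"

instance
  by standard (simp_all add: scaleR_fun_def fun_eq_iff scaleR_add_right scaleR_add_left)

end

section \<open>Sobolev spaces in dimension one\<close>

text \<open>\<open>g\<close> is an \<open>L\<^sup>2\<close> weak derivative of \<open>f\<close> on \<open>[a,b]\<close>, where \<open>f\<close> is the continuous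
  representative of its Sobolev class. Such a \<open>g\<close> is unique almost everywhere, so integrals
  involving \<open>weak_deriv\<close> below do not depend on the choice.\<close>

definition has_weak_deriv :: "real \<Rightarrow> real \<Rightarrow> (real \<Rightarrow> real) \<Rightarrow> (real \<Rightarrow> real) \<Rightarrow> bool"
  where "has_weak_deriv a b f g \<longleftrightarrow>
    set_borel_measurable lborel {a..b} g \<and>
    set_integrable lborel {a..b} (\<lambda>s. (g s)\<^sup>2) \<and>
    (\<forall>t\<in>{a..b}. f t = f a + (LBINT s:{a..t}. g s))"

definition H1 :: "real \<Rightarrow> real \<Rightarrow> (real \<Rightarrow> real) set"
  where "H1 a b = {f. \<exists>g. has_weak_deriv a b f g}"

definition weak_deriv :: "real \<Rightarrow> real \<Rightarrow> (real \<Rightarrow> real) \<Rightarrow> real \<Rightarrow> real"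
  where "weak_deriv a b f = (SOME g. has_weak_deriv a b f g)"

definition H1_periodic :: "real \<Rightarrow> (real \<Rightarrow> real) set"
  where "H1_periodic T = {f \<in> H1 0 T. \<forall>t. f (t + T) = f t}"

text \<open>Elements are extended by zero outside \<open>[0,T]\<close>, so that a function on \<open>[0,T]\<close> corresponds
  to exactly one function on the line and dimensions are not changed.\<close>

definition H1_dirichlet :: "real \<Rightarrow> (real \<Rightarrow> real) set"
  where "H1_dirichlet T = {f \<in> H1 0 T. f 0 = 0 \<and> f T = 0 \<and> (\<forall>t. t \<notin> {0..T} \<longrightarrow> f t = 0)}"

definition H1_norm :: "real \<Rightarrow> (real \<Rightarrow> real) \<Rightarrow> real"
  where "H1_norm T f = sqrt (LBINT t:{0..T}. (f t)\<^sup>2 + (weak_deriv 0 T f t)\<^sup>2)"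

section \<open>Second differential, Morse index and local minimizers\<close>

text \<open>\<open>d\<^sup>2F(x)[v,w]\<close>, as a mixed derivative along the plane through \<open>x\<close> spanned by \<open>v\<close> and \<open>w\<close>.
  Only used for functionals that are twice continuously differentiable on the space of
  variations, where it is the second differential.\<close>

definition second_differential :: "('a::real_vector \<Rightarrow> real) \<Rightarrow> 'a \<Rightarrow> 'a \<Rightarrow> 'a \<Rightarrow> real"
  where "second_differential F x v w =
    deriv (\<lambda>s. deriv (\<lambda>t. F (x + s *\<^sub>R v + t *\<^sub>R w)) 0) 0"

definition negative_definite_on :: "'a::real_vector set \<Rightarrow> ('a \<Rightarrow> 'a \<Rightarrow> real) \<Rightarrow> bool"
  where "negative_definite_on V B \<longleftrightarrow> (\<forall>v\<in>V. v \<noteq> 0 \<longrightarrow> B v v < 0)"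

text \<open>The supremum is restricted to finite-dimensional subspaces because \<open>dim\<close> is \<open>0\<close> on
  infinite-dimensional ones. An infinite-dimensional negative definite subspace contains
  finite-dimensional ones of every dimension, hence yields index \<open>\<infinity>\<close>.\<close>

definition morse_index :: "'a::real_vector set \<Rightarrow> ('a \<Rightarrow> 'a \<Rightarrow> real) \<Rightarrow> enat"
  where "morse_index E B =
    (SUP V \<in> {V. subspace V \<and> V \<subseteq> E \<and> (\<exists>S. finite S \<and> V = span S) \<and> negative_definite_on V B}.
       enat (dim V))"

definition local_minimizer ::
    "('a::real_vector \<Rightarrow> real) \<Rightarrow> 'a set \<Rightarrow> ('a \<Rightarrow> real) \<Rightarrow> 'a \<Rightarrow> bool"
  where "local_minimizer nrm X F x \<longleftrightarrow> (\<exists>\<epsilon>>0. \<forall>y\<in>X. nrm (y - x) < \<epsilon> \<longrightarrow> F x \<le> F y)"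

section \<open>The pendulum\<close>

definition pendulum_H :: "real \<Rightarrow> real \<Rightarrow> real"
  where "pendulum_H p q = p\<^sup>2 / 2 + (1 - cos q)"

definition pendulum_L :: "real \<Rightarrow> real \<Rightarrow> real"
  where "pendulum_L q v = v\<^sup>2 / 2 - (1 - cos q)"

definition librational_orbit :: "real \<Rightarrow> (real \<Rightarrow> real) \<Rightarrow> (real \<Rightarrow> real) \<Rightarrow> bool"
  where "librational_orbit k p q \<longleftrightarrow>
    (\<forall>t. (p has_real_derivative - sin (q t)) (at t)) \<and>
    (\<forall>t. (q has_real_derivative p t) (at t)) \<and>
    (\<forall>t. pendulum_H (p t) (q t) = k) \<and>
    p 0 = 0 \<and> q 0 = arccos (1 - k)"

definition minimal_period :: "(real \<Rightarrow> 'a) \<Rightarrow> real \<Rightarrow> bool"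
  where "minimal_period z T \<longleftrightarrow>
    T > 0 \<and> (\<forall>t. z (t + T) = z t) \<and> (\<forall>S. 0 < S \<and> S < T \<longrightarrow> \<not> (\<forall>t. z (t + S) = z t))"

definition action :: "real \<Rightarrow> (real \<Rightarrow> real) \<Rightarrow> real"
  where "action T q = (LBINT t:{0..T}. pendulum_L (q t) (weak_deriv 0 T q t))"

definition free_action :: "real \<Rightarrow> (real \<Rightarrow> real) \<times> real \<Rightarrow> real"
  where "free_action k = (\<lambda>(x, T).
    T * (LBINT s:{0..1}. pendulum_L (x s) (weak_deriv 0 1 x s / T) + k))"

definition index_periodic :: "real \<Rightarrow> (real \<Rightarrow> real) \<Rightarrow> enat"
  where "index_periodic T \<gamma> = morse_index (H1_periodic T) (second_differential (action T) \<gamma>)"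

definition index_dirichlet :: "real \<Rightarrow> (real \<Rightarrow> real) \<Rightarrow> enat"
  where "index_dirichlet T \<gamma> = morse_index (H1_dirichlet T) (second_differential (action T) \<gamma>)"

definition index_free :: "real \<Rightarrow> real \<Rightarrow> (real \<Rightarrow> real) \<Rightarrow> enat"
  where "index_free k T \<gamma> =
    morse_index (H1_periodic 1 \<times> UNIV)
      (second_differential (free_action k) (\<lambda>s. \<gamma> (T * s), T))"

end

theory Submission
  imports Defs
begin

text \<open>With \<open>m = k / 2\<close>, the functions \<open>cos (q / 2)\<close>, \<open>q'\<close>, \<open>sin (q / 2)\<close> are (multiples of) the Jacobi
  functions \<open>dn\<close>, \<open>cn\<close>, \<open>sn\<close> along the orbit, and they are eigenfunctions of the Hill operator
  \<open>L v = - v'' - cos q v\<close> with eigenvalues \<open>m - 1 < 0\<close>, \<open>0\<close>, \<open>m > 0\<close>. So \<open>cos (q / 2)\<close> is a negative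
  direction. Conversely, a variation \<open>v\<close> with \<open>v 0 = v T\<close> and \<open>v (T / 4) + v (3 T / 4) = 0\<close> becomes one
  that vanishes at the zeros of \<open>q\<close> after subtraction of a multiple of \<open>q'\<close>, which does not change the
  second variation; a Riccati substitution with \<open>sin (q / 2)\<close> then shows that the second variation is
  nonnegative. Hence the periodic and Dirichlet indices are at most one and the free-time index is at
  most two.

  For the free-time index, a periodic solution of \<open>L z = 2 sin q\<close> is
  \<open>z = \<theta> q' + 4 \<beta> sin q\<close> with \<open>\<theta> t = t - \<beta> \<integral>\<^sub>0\<^sup>t q'\<^sup>2\<close> and \<open>\<beta> = T / \<integral>\<^sub>0\<^sup>T q'\<^sup>2\<close>. The variation \<open>z\<close>,
  together with a change of period, is orthogonal to \<open>cos (q / 2)\<close> and has second variation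
  \<open>\<beta> \<integral>\<^sub>0\<^sup>T (q'\<^sup>4 - 8 sin\<^sup>2 q) = - 16 \<beta> m (1 - m) T\<close>, because
  \<open>q'\<^sup>4 - 8 sin\<^sup>2 q - 4 (q' sin q)' = - 16 m (1 - m)\<close>.\<close>

section \<open>Absolutely continuous functions and weak derivatives\<close>

text \<open>Absolute continuity with an integrable derivative. Square integrability is dropped
  because indefinite integrals of \<open>g\<^sup>2\<close> and of \<open>quad v g\<close> also
  occur, whose densities are only integrable.\<close>

definition has_L1_deriv :: "real \<Rightarrow> real \<Rightarrow> (real \<Rightarrow> real) \<Rightarrow> (real \<Rightarrow> real) \<Rightarrow> bool"
  where "has_L1_deriv a b f g \<longleftrightarrow>
    set_integrable lborel {a..b} g \<and> (\<forall>t\<in>{a..b}. f t = f a + (LBINT s:{a..t}. g s))"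

lemma has_L1_derivD:
  assumes "has_L1_deriv a b f g"
  shows "set_integrable lborel {a..b} g"
    and "t \<in> {a..b} \<Longrightarrow> f t = f a + (LBINT s:{a..t}. g s)"
  using assms unfolding has_L1_deriv_def by blast+

lemma has_weak_derivD:
  assumes "has_weak_deriv a b f g"
  shows "set_borel_measurable lborel {a..b} g"
    and "set_integrable lborel {a..b} (\<lambda>s. (g s)\<^sup>2)"
    and "t \<in> {a..b} \<Longrightarrow> f t = f a + (LBINT s:{a..t}. g s)"
  using assms unfolding has_weak_deriv_def by blast+

lemma set_integral_Icc_combine:
  fixes f :: "real \<Rightarrow> real"
  assumes "set_integrable lborel {a..b} f" "a \<le> c" "c \<le> b"
  shows "(LBINT s:{a..b}. f s) = (LBINT s:{a..c}. f s) + (LBINT s:{c..b}. f s)"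
proof -
  have i: "set_integrable lborel {a..c} f" "set_integrable lborel {c..b} f"
    by (rule set_integrable_subset[OF assms(1)]; use assms in auto)+
  show ?thesis
    using set_borel_integral_eq_integral[OF assms(1)] set_borel_integral_eq_integral[OF i(1)]
      set_borel_integral_eq_integral[OF i(2)] Henstock_Kurzweil_Integration.integral_combine[OF assms(2,3), of f]
    by simp
qed

text \<open>On a bounded interval L^2 is contained in L^1, by the pointwise bound
  \<open>\<bar>y\<bar> \<le> 1 + y\<^sup>2\<close>.\<close>

lemma has_weak_deriv_set_integrable:
  assumes "has_weak_deriv a b f g"
  shows "set_integrable lborel {a..b} g"
proof (rule set_integrable_bound)
  show "set_integrable lborel {a..b} (\<lambda>x. 1 + (g x)\<^sup>2)"
    using assms unfolding has_weak_deriv_def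
    by (intro set_integral_add(1)[OF borel_integrable_atLeastAtMost'[OF continuous_on_const]]) blast
  show "set_borel_measurable lborel {a..b} g"
    using assms unfolding has_weak_deriv_def by blast
  have "\<bar>y\<bar> \<le> 1 + y\<^sup>2" for y :: real
    using zero_le_power2[of "\<bar>y\<bar> - 1"] zero_le_power2[of y] unfolding power2_diff by simp
  then show "AE x in lborel. x \<in> {a..b} \<longrightarrow> norm (g x) \<le> norm (1 + (g x)\<^sup>2)"
    by (auto simp: abs_of_nonneg)
qed

lemma has_weak_deriv_imp_has_L1_deriv:
  "has_weak_deriv a b f g \<Longrightarrow> has_L1_deriv a b f g"
  using has_weak_deriv_set_integrable unfolding has_L1_deriv_def has_weak_deriv_def by blast

lemma has_L1_deriv_continuous_on:
  assumes "has_L1_deriv a b f g"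
  shows "continuous_on {a..b} f"
proof -
  have i: "set_integrable lborel {a..b} g" using assms by (simp add: has_L1_deriv_def)
  have *: "f t = f a + integral {a..t} g" if "t \<in> {a..b}" for t
  proof -
    have "set_integrable lborel {a..t} g"
      by (rule set_integrable_subset[OF i]) (use that in auto)
    then show ?thesis
      using has_L1_derivD(2)[OF assms that] set_borel_integral_eq_integral(2) by simp
  qed
  have "continuous_on {a..b} (\<lambda>t. f a + integral {a..t} g)"
    by (intro continuous_intros indefinite_integral_continuous_1 set_borel_integral_eq_integral(1)[OF i])
  moreover have "continuous_on {a..b} f \<longleftrightarrow> continuous_on {a..b} (\<lambda>t. f a + integral {a..t} g)"
    by (rule continuous_on_cong[OF refl]) (rule *)
  ultimately show ?thesis by simp
qed

lemma has_L1_deriv_diff: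
  assumes "has_L1_deriv a b f g" "a \<le> s" "s \<le> t" "t \<le> b"
  shows "f t - f s = (LBINT x:{s..t}. g x)"
proof -
  have "set_integrable lborel {a..t} g"
    by (rule set_integrable_subset[of _ "{a..b}"]) (use assms has_L1_derivD(1)[OF assms(1)] in auto)
  from set_integral_Icc_combine[OF this \<open>a \<le> s\<close> \<open>s \<le> t\<close>] show ?thesis
    using has_L1_derivD(2)[OF assms(1), of s] has_L1_derivD(2)[OF assms(1), of t] assms(2-) by simp
qed

lemma has_L1_deriv_subinterval:
  assumes "has_L1_deriv a b f g" "a \<le> c" "d \<le> b"
  shows "has_L1_deriv c d f g"
  unfolding has_L1_deriv_def
proof (intro conjI ballI)
  show "set_integrable lborel {c..d} g"
    by (rule set_integrable_subset[of _ "{a..b}"]) (use assms has_L1_derivD(1)[OF assms(1)] in auto)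
  fix t assume "t \<in> {c..d}"
  then show "f t = f c + (LBINT s:{c..t}. g s)"
    using has_L1_deriv_diff[OF assms(1), of c t] assms by auto
qed

lemma set_borel_measurable_continuous_mult:
  fixes f g :: "real \<Rightarrow> real"
  assumes "set_borel_measurable lborel {a..b} g" "continuous_on {a..b} f"
  shows "set_borel_measurable lborel {a..b} (\<lambda>x. f x * g x)"
proof -
  have "set_borel_measurable borel {a..b} f"
    by (rule set_measurable_continuous_on) (use assms in auto)
  then have "(\<lambda>x. (indicator {a..b} x *\<^sub>R f x) * (indicator {a..b} x *\<^sub>R g x)) \<in> borel_measurable lborel"
    using assms(1) unfolding set_borel_measurable_def by (intro borel_measurable_times) auto
  also have "(\<lambda>x. (indicator {a..b} x *\<^sub>R f x) * (indicator {a..b} x *\<^sub>R g x)) = (\<lambda>x. indicator {a..b} x *\<^sub>R (f x * g x))"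
    by (auto simp: fun_eq_iff indicator_def)
  finally show ?thesis unfolding set_borel_measurable_def .
qed

lemma set_integrable_continuous_mult:
  fixes f g :: "real \<Rightarrow> real"
  assumes g: "set_integrable lborel {a..b} g" and f: "continuous_on {a..b} f"
  shows "set_integrable lborel {a..b} (\<lambda>x. f x * g x)"
proof -
  have "bounded (f ` {a..b})" using f by (simp add: compact_continuous_image compact_imp_bounded)
  then obtain B where B: "\<forall>x\<in>{a..b}. \<bar>f x\<bar> \<le> B" "B > 0"
    unfolding bounded_pos by auto
  show ?thesis
  proof (rule set_integrable_bound[where f = "\<lambda>x. B * g x"])
    show "set_integrable lborel {a..b} (\<lambda>x. B * g x)" using g by simp
    show "set_borel_measurable lborel {a..b} (\<lambda>x. f x * g x)"
      by (rule set_borel_measurable_continuous_mult[OF _ f])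
        (use g in \<open>auto simp: set_integrable_def set_borel_measurable_def\<close>)
    show "AE x in lborel. x \<in> {a..b} \<longrightarrow> norm (f x * g x) \<le> norm (B * g x)"
      using B by (auto simp: abs_mult intro!: mult_right_mono)
  qed
qed

lemma set_integrable_mult_square:
  fixes f g :: "real \<Rightarrow> real"
  assumes "set_borel_measurable lborel {a..b} f" "set_borel_measurable lborel {a..b} g"
    "set_integrable lborel {a..b} (\<lambda>x. (f x)\<^sup>2)" "set_integrable lborel {a..b} (\<lambda>x. (g x)\<^sup>2)"
  shows "set_integrable lborel {a..b} (\<lambda>x. f x * g x)"
proof (rule set_integrable_bound[where f = "\<lambda>x. (f x)\<^sup>2 + (g x)\<^sup>2"])
  show "set_integrable lborel {a..b} (\<lambda>x. (f x)\<^sup>2 + (g x)\<^sup>2)" using assms by auto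
  have "(\<lambda>x. (indicator {a..b} x *\<^sub>R f x) * (indicator {a..b} x *\<^sub>R g x)) \<in> borel_measurable lborel"
    using assms(1,2) unfolding set_borel_measurable_def by (intro borel_measurable_times) auto
  also have "(\<lambda>x. (indicator {a..b} x *\<^sub>R f x) * (indicator {a..b} x *\<^sub>R g x)) = (\<lambda>x. indicator {a..b} x *\<^sub>R (f x * g x))"
    by (auto simp: fun_eq_iff indicator_def)
  finally show "set_borel_measurable lborel {a..b} (\<lambda>x. f x * g x)"
    unfolding set_borel_measurable_def .
  have "\<bar>u * v\<bar> \<le> u\<^sup>2 + v\<^sup>2" for u v :: real
    using sum_squares_bound[of "\<bar>u\<bar>" "\<bar>v\<bar>"] mult_nonneg_nonneg[of "\<bar>u\<bar>" "\<bar>v\<bar>"]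
    unfolding abs_mult power2_abs by linarith
  then show "AE x in lborel. x \<in> {a..b} \<longrightarrow> norm (f x * g x) \<le> norm ((f x)\<^sup>2 + (g x)\<^sup>2)"
    by (auto simp: abs_of_nonneg)
qed

lemma has_weak_deriv_add_scaled:
  assumes f: "has_weak_deriv a b f f'" and g: "has_weak_deriv a b g g'"
  shows "has_weak_deriv a b (\<lambda>t. f t + r * g t) (\<lambda>t. f' t + r * g' t)"
proof -
  have mf: "set_borel_measurable lborel {a..b} f'" and mg: "set_borel_measurable lborel {a..b} g'"
    and sf: "set_integrable lborel {a..b} (\<lambda>x. (f' x)\<^sup>2)" and sg: "set_integrable lborel {a..b} (\<lambda>x. (g' x)\<^sup>2)"
    using f g by (blast dest: has_weak_derivD)+
  have i: "set_integrable lborel {a..b} (\<lambda>x. f' x * g' x)"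
    by (rule set_integrable_mult_square[OF mf mg sf sg])
  have "set_integrable lborel {a..b} (\<lambda>x. (f' x)\<^sup>2 + (2 * r) * (f' x * g' x) + r\<^sup>2 * (g' x)\<^sup>2)"
    using sf sg i by (intro set_integral_add(1) set_integrable_mult_right) auto
  then have 1: "set_integrable lborel {a..b} (\<lambda>x. (f' x + r * g' x)\<^sup>2)"
    by (simp add: power2_eq_square algebra_simps)
  have if': "set_integrable lborel {a..b} f'" and ig': "set_integrable lborel {a..b} g'"
    using f g has_weak_deriv_set_integrable by blast+
  then have i1: "set_integrable lborel {a..b} (\<lambda>x. f' x + r * g' x)"
    by (intro set_integral_add(1) set_integrable_mult_right) auto
  then have 2: "set_borel_measurable lborel {a..b} (\<lambda>x. f' x + r * g' x)"
    by (auto simp: set_integrable_def set_borel_measurable_def)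
  have 3: "f t + r * g t = f a + r * g a + (LBINT s:{a..t}. f' s + r * g' s)" if t: "t \<in> {a..b}" for t
  proof -
    have "set_integrable lborel {a..t} f'" "set_integrable lborel {a..t} g'"
      by (rule set_integrable_subset[OF if'] set_integrable_subset[OF ig']; use t in auto)+
    then have "(LBINT s:{a..t}. f' s + r * g' s) = (LBINT s:{a..t}. f' s) + r * (LBINT s:{a..t}. g' s)"
      by (subst set_integral_add(2)) auto
    moreover have "f t = f a + (LBINT s:{a..t}. f' s)" "g t = g a + (LBINT s:{a..t}. g' s)"
      using has_weak_derivD(3)[OF f t] has_weak_derivD(3)[OF g t] .
    ultimately show ?thesis by (simp add: algebra_simps)
  qed
  show ?thesis using 1 2 3 unfolding has_weak_deriv_def by blast
qed

lemma has_weak_deriv_cong: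
  assumes "has_weak_deriv a b f g" "\<And>t. t \<in> {a..b} \<Longrightarrow> f t = f2 t"
  shows "has_weak_deriv a b f2 g"
proof -
  have "f2 t = f2 a + (LBINT s:{a..t}. g s)" if "t \<in> {a..b}" for t
  proof -
    have "a \<in> {a..b}" using that by auto
    then show ?thesis using has_weak_derivD(3)[OF assms(1) that] assms(2) that by simp
  qed
  then show ?thesis using assms(1) unfolding has_weak_deriv_def by blast
qed

section \<open>Almost everywhere uniqueness of weak derivatives\<close>

text \<open>Lebesgue differentiation: off a negligible set the integrand is the limit of its means
  over \<open>[x, x + r]\<close>, and these means vanish as differences of the given
  integrals.\<close>

lemma set_integral_eq_0_imp_AE_eq_0:
  fixes g :: "real \<Rightarrow> real"
  assumes g: "set_integrable lborel {a..b} g"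
    and z: "\<And>t. t \<in> {a..b} \<Longrightarrow> (LBINT s:{a..t}. g s) = 0"
  shows "AE t in lborel. t \<in> {a..b} \<longrightarrow> g t = 0"
proof -
  define h where "h = (\<lambda>x. indicator {a..b} x * g x)"
  have hi: "integrable lborel h" using g unfolding h_def set_integrable_def by simp
  have hset: "set_integrable lborel {c..d} h" for c d
    unfolding set_integrable_def using hi
    by (intro integrable_mult_indicator) auto
  then have hk: "h integrable_on cbox c d" for c d
    using set_borel_integral_eq_integral(1)[OF hset] by simp
  have zz: "integral (cbox x (x + r)) h = 0" if "a < x" "x < b" "0 < r" "r < b - x" for x r
  proof -
    have "integral (cbox x (x + r)) h = (LBINT s:{x..x+r}. h s)"
      using set_borel_integral_eq_integral(2)[OF hset] by simp
    also have "\<dots> = (LBINT s:{x..x+r}. g s)"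
      by (rule set_lebesgue_integral_cong) (use that in \<open>auto simp: h_def\<close>)
    also have "\<dots> = (LBINT s:{a..x+r}. g s) - (LBINT s:{a..x}. g s)"
      using set_integral_Icc_combine[OF set_integrable_subset[OF g, of "{a..x+r}"], of x] that by auto
    also have "\<dots> = 0" using that z by auto
    finally show ?thesis .
  qed
  obtain N where N: "negligible N" and lim: "\<And>x e. \<lbrakk>x \<notin> N; 0 < e\<rbrakk> \<Longrightarrow>
      \<exists>d>0. \<forall>r. 0 < r \<and> r < d \<longrightarrow> norm (integral (cbox x (x + r *\<^sub>R One)) h /\<^sub>R r ^ DIM(real) - h x) < e"
    using integrable_ccontinuous_explicit[OF hk] by metis
  have h0: "h x = 0" if x: "x \<notin> N \<union> {a, b}" for x
  proof (cases "a < x \<and> x < b")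
    case True
    show ?thesis
    proof (rule ccontr)
      assume "h x \<noteq> 0"
      \<comment> \<open>For small \<open>r\<close> the mean is 0, so its distance to
        \<open>h x\<close> equals \<open>\<bar>h x\<bar>\<close> and cannot be smaller than
        that.\<close>
      then obtain d where d: "d > 0" "\<And>r. 0 < r \<Longrightarrow> r < d \<Longrightarrow>
          norm (integral (cbox x (x + r *\<^sub>R One)) h /\<^sub>R r ^ DIM(real) - h x) < \<bar>h x\<bar>"
        using lim[of x "\<bar>h x\<bar>"] x by auto
      define r where "r = min d (b - x) / 2"
      have "0 < r" "r < d" "r < b - x" using d True unfolding r_def by (auto simp: min_def)
      then show False using d(2)[of r] zz[of x r] True by simp
    qed
  next
    case False
    then show ?thesis using x by (auto simp: h_def indicator_def)
  qed
  have "N \<union> {a, b} \<in> null_sets lebesgue"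
    using N by (auto simp: negligible_iff_null_sets[symmetric])
  then have "AE x in lebesgue. h x = 0"
    using h0 by (intro AE_I'[of "N \<union> {a,b}"]) auto
  \<comment> \<open>Borel measurability of \<open>h\<close> lets the statement descend from the
    completed measure to \<open>lborel\<close>.\<close>
  moreover have hm: "h \<in> borel_measurable lborel" using hi by simp
  ultimately have "AE x in lborel. h x = 0"
    by (subst (asm) AE_completion_iff) auto
  then show ?thesis
    by eventually_elim (auto simp: h_def)
qed

lemma has_weak_deriv_unique:
  assumes "has_weak_deriv a b f g" "has_weak_deriv a b f h"
  shows "AE t in lborel. t \<in> {a..b} \<longrightarrow> g t = h t"
proof -
  have *: "has_weak_deriv a b (\<lambda>t. f t + (-1) * f t) (\<lambda>t. g t + (-1) * h t)"
    by (rule has_weak_deriv_add_scaled[OF assms])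
  then have "AE t in lborel. t \<in> {a..b} \<longrightarrow> g t + (-1) * h t = 0"
    by (intro set_integral_eq_0_imp_AE_eq_0 has_weak_deriv_set_integrable[OF *])
      (use has_weak_derivD(3)[OF *] in simp)
  then show ?thesis by eventually_elim auto
qed

section \<open>Integration by parts and criteria for weak derivatives\<close>

text \<open>Fubini for \<open>f' s * g' t\<close> on the triangle \<open>s \<le> t\<close>, which
  \<open>indicator {s..} t\<close> cuts out. Integrating out \<open>s\<close> leaves
  \<open>(f t - f a) * g' t\<close>, integrating out \<open>t\<close> leaves
  \<open>(g b - g s) * f' s\<close>; equating both integrals gives the formula.\<close>

lemma has_L1_deriv_mult_aux:
  assumes ab: "a \<le> b" and f: "has_L1_deriv a b f f'" and g: "has_L1_deriv a b g g'"
  shows "(LBINT t:{a..b}. f' t * g t + f t * g' t) = f b * g b - f a * g a"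
proof -
  define F where "F = (\<lambda>x. indicator {a..b} x * f' x)"
  define G where "G = (\<lambda>x. indicator {a..b} x * g' x)"
  have Fi: "integrable lborel F" and Gi: "integrable lborel G"
    using has_L1_derivD(1)[OF f] has_L1_derivD(1)[OF g] unfolding F_def G_def set_integrable_def by auto
  have [measurable]: "F \<in> borel_measurable lborel" "G \<in> borel_measurable lborel"
    using Fi Gi by auto
  have FG: "integrable (lborel \<Otimes>\<^sub>M lborel) (\<lambda>(s,t). F s * G t)"
    by (rule lborel_pair.Fubini_integrable)
      (use Fi Gi in \<open>auto simp: abs_mult\<close>)
  have tri: "integrable (lborel \<Otimes>\<^sub>M lborel) (\<lambda>(s,t). indicator {s..} t * (F s * G t))"
    by (rule Bochner_Integration.integrable_bound[OF FG])
      (auto simp: indicator_def)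
  have cf: "continuous_on {a..b} f" and cg: "continuous_on {a..b} g"
    using f g has_L1_deriv_continuous_on by auto
  have f'i: "set_integrable lborel {a..b} f'" and g'i: "set_integrable lborel {a..b} g'"
    using has_L1_derivD(1)[OF f] has_L1_derivD(1)[OF g] .
  have i1: "set_integrable lborel {a..b} (\<lambda>t. g t * f' t)"
    by (rule set_integrable_continuous_mult[OF f'i cg])
  have i2: "set_integrable lborel {a..b} (\<lambda>t. f t * g' t)"
    by (rule set_integrable_continuous_mult[OF g'i cf])
  have A: "(\<integral>s. indicator {s..} t * (F s * G t) \<partial>lborel) = indicator {a..b} t * ((f t - f a) * g' t)" for t
  proof (cases "t \<in> {a..b}")
    case True
    have "(\<integral>s. indicator {s..} t * (F s * G t) \<partial>lborel) = (\<integral>s. (indicator {a..t} s * f' s) * g' t \<partial>lborel)"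
      by (rule Bochner_Integration.integral_cong) (use True in \<open>auto simp: F_def G_def indicator_def\<close>)
    also have "\<dots> = (LBINT s:{a..t}. f' s) * g' t"
      by (simp add: set_lebesgue_integral_def)
    also have "(LBINT s:{a..t}. f' s) = f t - f a"
      using has_L1_derivD(2)[OF f True] by simp
    finally show ?thesis using True by simp
  qed (simp add: G_def)
  have B: "(\<integral>t. indicator {s..} t * (F s * G t) \<partial>lborel) = indicator {a..b} s * ((g b - g s) * f' s)" for s
  proof (cases "s \<in> {a..b}")
    case True
    have "(\<integral>t. indicator {s..} t * (F s * G t) \<partial>lborel) = (\<integral>t. (indicator {s..b} t * g' t) * f' s \<partial>lborel)"
      by (rule Bochner_Integration.integral_cong) (use True in \<open>auto simp: F_def G_def indicator_def\<close>)
    also have "\<dots> = (LBINT t:{s..b}. g' t) * f' s"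
      by (simp add: set_lebesgue_integral_def)
    also have "(LBINT t:{s..b}. g' t) = g b - g s"
      using has_L1_deriv_diff[OF g] True by auto
    finally show ?thesis using True by simp
  qed (simp add: F_def)
  have "(LBINT t:{a..b}. (f t - f a) * g' t) = (LBINT s:{a..b}. (g b - g s) * f' s)"
    using lborel_pair.Fubini_integral[OF tri] unfolding A B set_lebesgue_integral_def by simp
  moreover have "(LBINT t:{a..b}. (f t - f a) * g' t) = (LBINT t:{a..b}. f t * g' t) - f a * (LBINT t:{a..b}. g' t)"
    using i2 g'i by (simp add: left_diff_distrib set_integral_diff(2))
  moreover have "(LBINT s:{a..b}. (g b - g s) * f' s) = g b * (LBINT t:{a..b}. f' t) - (LBINT t:{a..b}. g t * f' t)"
    using i1 f'i by (simp add: left_diff_distrib set_integral_diff(2))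
  moreover have "(LBINT t:{a..b}. f' t) = f b - f a" "(LBINT t:{a..b}. g' t) = g b - g a"
    using has_L1_deriv_diff[OF f, of a b] has_L1_deriv_diff[OF g, of a b] ab by auto
  moreover have "(LBINT t:{a..b}. f' t * g t + f t * g' t) = (LBINT t:{a..b}. g t * f' t) + (LBINT t:{a..b}. f t * g' t)"
    unfolding set_integral_add(2)[OF i1 i2, symmetric] by (simp only: mult.commute)
  moreover have alg: "R = f b * g b - f a * g a"
    if "A = B" "A = P - f a * I" "B = g b * J - Q" "J = f b - f a" "I = g b - g a" "R = Q + P"
    for A B P Q R I J :: real
    using that by (simp add: algebra_simps)
  ultimately show ?thesis by - (rule alg)
qed

lemma has_L1_deriv_mult:
  assumes f: "has_L1_deriv a b f f'" and g: "has_L1_deriv a b g g'"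
  shows "has_L1_deriv a b (\<lambda>t. f t * g t) (\<lambda>t. f' t * g t + f t * g' t)"
  unfolding has_L1_deriv_def
proof (intro conjI ballI)
  have "set_integrable lborel {a..b} (\<lambda>t. g t * f' t + f t * g' t)"
    by (intro set_integral_add(1) set_integrable_continuous_mult has_L1_deriv_continuous_on
        has_L1_derivD(1)[OF f] has_L1_derivD(1)[OF g]) (use f g in blast)+
  then show "set_integrable lborel {a..b} (\<lambda>t. f' t * g t + f t * g' t)"
    by (simp only: mult.commute)
  fix t assume "t \<in> {a..b}"
  then have t: "a \<le> a" "a \<le> t" "t \<le> b" by auto
  show "f t * g t = f a * g a + (LBINT s:{a..t}. f' s * g s + f s * g' s)"
    unfolding has_L1_deriv_mult_aux[OF t(2) has_L1_deriv_subinterval[OF f t(1,3)]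
      has_L1_deriv_subinterval[OF g t(1,3)]] by simp
qed

text \<open>The exceptional set \<open>S\<close> admits corners, as in the Dirichlet test function
  below. The bound makes \<open>g\<close> square integrable, and the fundamental theorem for the
  gauge integral tolerates finitely many exceptional points.\<close>

lemma has_weak_deriv_piecewise:
  assumes S: "finite S" and cont: "continuous_on {a..b} f"
    and deriv: "\<And>x. x \<in> {a<..<b} - S \<Longrightarrow> (f has_real_derivative g x) (at x)"
    and meas: "set_borel_measurable lborel {a..b} g"
    and bound: "\<And>x. x \<in> {a..b} \<Longrightarrow> \<bar>g x\<bar> \<le> B"
  shows "has_weak_deriv a b f g"
  unfolding has_weak_deriv_def
proof (intro conjI ballI)
  have const: "set_integrable lborel {a..b} (\<lambda>x. C)" for C :: real
    by (intro borel_integrable_atLeastAtMost') auto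
  have gi: "set_integrable lborel {a..b} g"
    by (rule set_integrable_bound[OF const[of B] meas]) (use bound in force)
  show "set_borel_measurable lborel {a..b} g" by fact
  have "(\<lambda>x. (indicator {a..b} x *\<^sub>R g x)\<^sup>2) \<in> borel_measurable lborel"
    using meas unfolding set_borel_measurable_def by measurable
  also have "(\<lambda>x. (indicator {a..b} x *\<^sub>R g x)\<^sup>2) = (\<lambda>x. indicator {a..b} x *\<^sub>R (g x)\<^sup>2)"
    by (auto simp: fun_eq_iff indicator_def)
  finally have m2: "set_borel_measurable lborel {a..b} (\<lambda>x. (g x)\<^sup>2)"
    unfolding set_borel_measurable_def .
  have "(g x)\<^sup>2 \<le> B\<^sup>2" if "x \<in> {a..b}" for x
    using bound[OF that] abs_le_square_iff[of "g x" B] by auto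
  then show "set_integrable lborel {a..b} (\<lambda>s. (g s)\<^sup>2)"
    by (intro set_integrable_bound[OF const[of "B\<^sup>2"] m2]) auto
  fix t assume t: "t \<in> {a..b}"
  have ti: "set_integrable lborel {a..t} g" by (rule set_integrable_subset[OF gi]) (use t in auto)
  have "(g has_integral f t - f a) {a..t}"
    by (rule fundamental_theorem_of_calculus_interior_strong[OF S])
      (use t deriv in \<open>auto simp: has_real_derivative_iff_has_vector_derivative[symmetric]
        intro: continuous_on_subset[OF cont]\<close>)
  then show "f t = f a + (LBINT s:{a..t}. g s)"
    using set_borel_integral_eq_integral(2)[OF ti] by (simp add: integral_unique)
qed

lemma has_weak_deriv_C1:
  assumes deriv: "\<And>x. x \<in> {a..b} \<Longrightarrow> (f has_real_derivative g x) (at x)"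
    and g: "continuous_on {a..b} g"
  shows "has_weak_deriv a b f g"
proof -
  have "bounded (g ` {a..b})" using g by (simp add: compact_continuous_image compact_imp_bounded)
  then obtain B where B: "\<forall>x\<in>{a..b}. \<bar>g x\<bar> \<le> B"
    unfolding bounded_iff by auto
  show ?thesis
  proof (rule has_weak_deriv_piecewise[of "{}"])
    show "continuous_on {a..b} f"
      using deriv by (meson DERIV_continuous_on has_field_derivative_at_within)
    show "set_borel_measurable lborel {a..b} g"
      using set_measurable_continuous_on[OF _ g] by (simp add: set_borel_measurable_def)
  qed (use deriv B in auto)
qed

section \<open>Morse index and second differential\<close>

text \<open>With both directions equal to \<open>v\<close>, the inner derivative at
  \<open>x + s *\<^sub>R v\<close> is the derivative at \<open>r = s\<close> of one function of a
  real variable, so the mixed derivative is an ordinary second derivative.\<close>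

lemma second_differential_diagonal:
  fixes F :: "'a::real_vector \<Rightarrow> real"
  assumes D: "\<forall>\<^sub>F r in nhds 0. ((\<lambda>r. F (x + r *\<^sub>R v)) has_real_derivative D r) (at r)"
    and E: "(D has_real_derivative E) (at 0)"
  shows "second_differential F x v v = E"
proof -
  have "\<forall>\<^sub>F s in nhds 0. deriv (\<lambda>t. F (x + s *\<^sub>R v + t *\<^sub>R v)) 0 = D s"
    using D
  proof eventually_elim
    case (elim s)
    have "((\<lambda>t. F (x + (t + s) *\<^sub>R v)) has_real_derivative D s) (at 0)"
      using DERIV_shift[of "\<lambda>r. F (x + r *\<^sub>R v)" "D s" 0 s] elim by simp
    moreover have "(\<lambda>t. F (x + (t + s) *\<^sub>R v)) = (\<lambda>t. F (x + s *\<^sub>R v + t *\<^sub>R v))"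
      by (simp add: scaleR_add_left algebra_simps)
    ultimately show ?case by (simp add: DERIV_imp_deriv)
  qed
  then have "second_differential F x v v = deriv D 0"
    unfolding second_differential_def by (rule deriv_cong_ev) simp
  with E show ?thesis by (simp add: DERIV_imp_deriv)
qed

lemma second_differential_zero: "second_differential F x 0 0 = 0"
  unfolding second_differential_def by simp

text \<open>Since \<open>D 0 = 0\<close> and \<open>E < 0\<close>, \<open>D\<close> is negative just
  to the right of 0, and the mean value theorem makes \<open>F\<close> smaller at
  \<open>x + h *\<^sub>R v\<close>. Homogeneity of \<open>nrm\<close> along \<open>v\<close> places
  this point in any given ball.\<close>

lemma not_local_minimizer_second_order:
  fixes F :: "'a::real_vector \<Rightarrow> real"
  assumes D: "\<forall>\<^sub>F r in nhds 0. ((\<lambda>r. F (x + r *\<^sub>R v)) has_real_derivative D r) (at r)"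
    and E: "(D has_real_derivative E) (at 0)" "D 0 = 0" "E < 0"
    and X: "\<And>r. x + r *\<^sub>R v \<in> X"
    and nrm: "\<And>r. nrm (r *\<^sub>R v) = \<bar>r\<bar> * N"
  shows "\<not> local_minimizer nrm X F x"
proof
  assume "local_minimizer nrm X F x"
  then obtain e where e: "e > 0" "\<And>y. y \<in> X \<Longrightarrow> nrm (y - x) < e \<Longrightarrow> F x \<le> F y"
    unfolding local_minimizer_def by blast
  obtain d1 where d1: "d1 > 0"
    "\<And>r. \<bar>r\<bar> < d1 \<Longrightarrow> ((\<lambda>r. F (x + r *\<^sub>R v)) has_real_derivative D r) (at r)"
    using D unfolding eventually_nhds_metric dist_real_def by auto
  obtain d2 where d2: "d2 > 0" "\<And>h. 0 < h \<Longrightarrow> h < d2 \<Longrightarrow> D h < 0"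
    using DERIV_neg_dec_right[OF E(1) E(3)] E(2) by auto
  \<comment> \<open>The denominator \<open>\<bar>N\<bar> + 1\<close> is positive also when
    \<open>N\<close> is zero or negative.\<close>
  have e': "0 < e / (\<bar>N\<bar> + 1)" using e(1) by (intro divide_pos_pos) auto
  obtain h where "0 < h" "h < min (min d1 d2) (e / (\<bar>N\<bar> + 1))"
    using dense[of 0 "min (min d1 d2) (e / (\<bar>N\<bar> + 1))"] d1(1) d2(1) e' by auto
  then have h: "0 < h" "h < d1" "h < d2" "h < e / (\<bar>N\<bar> + 1)" by auto
  have "\<exists>z>0. z < h \<and> F (x + h *\<^sub>R v) - F (x + 0 *\<^sub>R v) = (h - 0) * D z"
    by (rule MVT2[OF h(1)]) (use d1(2) h in auto)
  then obtain z where z: "0 < z" "z < h" "F (x + h *\<^sub>R v) - F x = h * D z" by auto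
  have "h * D z < 0" using d2(2)[of z] z h by (auto intro: mult_pos_neg)
  then have "F (x + h *\<^sub>R v) < F x" using z by simp
  moreover have "nrm (h *\<^sub>R v) < e"
  proof -
    have "h * N \<le> h * (\<bar>N\<bar> + 1)" using h by (intro mult_left_mono) auto
    also have "\<dots> < e" using h(4) by (simp add: pos_less_divide_eq)
    finally show ?thesis using nrm[of h] h by simp
  qed
  ultimately show False using e(2)[OF X[of h]] by simp
qed

section \<open>Upper and lower bounds for the Morse index\<close>

text \<open>On a negative definite subspace \<open>V\<close> of \<open>E\<close> the map
  \<open>f\<close> is injective: a nonzero kernel vector would have both \<open>B v v < 0\<close>
  and \<open>B v v \<ge> 0\<close>. Hence the dimension of \<open>V\<close> is at most that of the
  target.\<close>

lemma morse_index_le_DIM: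
  fixes f :: "'a::real_vector \<Rightarrow> 'b::euclidean_space"
  assumes f: "linear f" and E: "\<And>v. v \<in> E \<Longrightarrow> f v = 0 \<Longrightarrow> B v v \<ge> 0"
  shows "morse_index E B \<le> enat DIM('b)"
  unfolding morse_index_def
proof (rule SUP_least)
  fix V assume "V \<in> {V. subspace V \<and> V \<subseteq> E \<and> (\<exists>S. finite S \<and> V = span S) \<and> negative_definite_on V B}"
  then have V: "subspace V" "V \<subseteq> E" "negative_definite_on V B" by auto
  have inj: "inj_on f V"
  proof (rule inj_onI)
    fix u w assume uw: "u \<in> V" "w \<in> V" "f u = f w"
    have "u - w \<in> V" using uw V(1) by (simp add: subspace_diff)
    moreover have "f (u - w) = 0" using uw(3) linear_diff[OF f, of u w] by simp
    ultimately show "u = w"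
      using E[of "u - w"] V(2,3) unfolding negative_definite_on_def by force
  qed
  obtain A where A: "A \<subseteq> V" "independent A" "V \<subseteq> span A" "card A = dim V"
    using basis_exists[of V] by metis
  have "span A = V" using A V(1) by (meson span_minimal subset_antisym)
  then have "independent (f ` A)"
    using linear_independent_injective_image[OF f A(2)] inj by simp
  then have "card (f ` A) \<le> DIM('b)" by (rule independent_bound[THEN conjunct2])
  moreover have "card (f ` A) = card A"
    using inj A(1) by (meson card_image inj_on_subset)
  ultimately show "enat (dim V) \<le> enat DIM('b)" using A(4) by simp
qed

text \<open>\<open>B\<close> is not assumed bilinear, so negativity is asked for every nonzero
  multiple of \<open>v\<close>. Together with \<open>B 0 0 = 0\<close> it forces
  \<open>v \<noteq> 0\<close>.\<close>

lemma morse_index_ge_1: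
  assumes E: "subspace E" "v \<in> E" and B0: "B 0 0 = 0"
    and neg: "\<And>a. a \<noteq> 0 \<Longrightarrow> B (a *\<^sub>R v) (a *\<^sub>R v) < 0"
  shows "morse_index E B \<ge> 1"
proof -
  have "v \<noteq> 0" using neg[of 1] B0 by auto
  then have dim: "dim (span {v}) = 1"
    by (subst dim_span_eq_card_independent) auto
  have "span {v} \<subseteq> E" using E by (simp add: span_minimal)
  moreover have "negative_definite_on (span {v}) B"
    unfolding negative_definite_on_def span_singleton using neg by auto
  ultimately have "enat (dim (span {v})) \<le> morse_index E B"
    unfolding morse_index_def by (intro SUP_upper) auto
  then show ?thesis unfolding dim by (simp add: one_enat_def)
qed

text \<open>Linear independence of \<open>u\<close> and \<open>v\<close> comes for free: a
  nontrivial combination equal to 0 would have value \<open>B 0 0 = 0\<close>, which is not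
  negative.\<close>

lemma morse_index_ge_2:
  assumes E: "subspace E" "u \<in> E" "v \<in> E" and B0: "B 0 0 = 0"
    and neg: "\<And>a b. a \<noteq> 0 \<or> b \<noteq> 0 \<Longrightarrow> B (a *\<^sub>R u + b *\<^sub>R v) (a *\<^sub>R u + b *\<^sub>R v) < 0"
  shows "morse_index E B \<ge> 2"
proof -
  have lin: "a = 0 \<and> b = 0" if "a *\<^sub>R u + b *\<^sub>R v = 0" for a b
    using neg[of a b] B0 that by auto
  have uv: "u \<noteq> v" using lin[of 1 "-1"] by auto
  have "v \<noteq> 0" using lin[of 0 1] by auto
  moreover have "u \<notin> span {v}"
  proof
    assume "u \<in> span {v}"
    then obtain c where "u = c *\<^sub>R v" by (auto simp: span_singleton)
    then show False using lin[of 1 "-c"] by simp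
  qed
  ultimately have "independent {u, v}" using uv by (simp add: independent_insert)
  then have dim: "dim (span {u, v}) = 2"
    using uv by (simp add: dim_eq_card_independent)
  have "span {u, v} \<subseteq> E" using E by (intro span_minimal) auto
  moreover have "negative_definite_on (span {u, v}) B"
    unfolding negative_definite_on_def
  proof (intro ballI impI)
    fix w assume w: "w \<in> span {u, v}" "w \<noteq> 0"
    obtain a where "w - a *\<^sub>R u \<in> span {v}" using w(1) by (auto simp: span_insert)
    then obtain b where "w - a *\<^sub>R u = b *\<^sub>R v" by (auto simp: span_singleton)
    then have "w = a *\<^sub>R u + b *\<^sub>R v" by (simp add: algebra_simps)
    moreover from this w(2) have "a \<noteq> 0 \<or> b \<noteq> 0" by auto
    ultimately show "B w w < 0" using neg by simp
  qed
  ultimately have "enat (dim (span {u, v})) \<le> morse_index E B"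
    unfolding morse_index_def by (intro SUP_upper CollectI conjI exI[of _ "{u, v}"]) auto
  then show ?thesis unfolding dim by (simp add: numeral_eq_enat)
qed

section \<open>The second variation of the action\<close>

text \<open>A common generalization: length \<open>l = 1\<close> gives the free-period functional,
  and freezing the period variable at 1 with \<open>k = 0\<close> gives the action on
  \<open>[0, l]\<close>. One computation of the second variation then serves both.\<close>

definition free_time_action :: "real \<Rightarrow> real \<Rightarrow> (real \<Rightarrow> real) \<times> real \<Rightarrow> real"
  where "free_time_action l k = (\<lambda>(x, T).
    T * (LBINT s:{0..l}. pendulum_L (x s) (weak_deriv 0 l x s / T) + k))"

lemma free_action_eq: "free_action k = free_time_action 1 k"
  unfolding free_action_def free_time_action_def ..

lemma action_eq: "action T x = free_time_action T 0 (x, 1)"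
  unfolding action_def free_time_action_def by simp

text \<open>Allows the representative selected by \<open>weak_deriv\<close> to be exchanged for an
  explicit weak derivative.\<close>

lemma set_integral_cong_AE_set_integrable:
  fixes f g :: "real \<Rightarrow> real"
  assumes "set_integrable lborel A f" "set_integrable lborel A g"
    and "AE t in lborel. t \<in> A \<longrightarrow> f t = g t"
  shows "(LBINT t:A. f t) = (LBINT t:A. g t)"
  unfolding set_lebesgue_integral_def
proof (rule integral_cong_AE)
  show "AE t in lborel. indicat_real A t *\<^sub>R f t = indicat_real A t *\<^sub>R g t"
    using assms(3) by eventually_elim (auto simp: indicator_def)
qed (use assms(1,2) in \<open>auto simp: set_integrable_def\<close>)

lemma has_weak_deriv_continuous_on:
  "has_weak_deriv a b f g \<Longrightarrow> continuous_on {a..b} f"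
  by (rule has_L1_deriv_continuous_on[OF has_weak_deriv_imp_has_L1_deriv])

lemma set_integral_add_scaled_square:
  fixes f g :: "real \<Rightarrow> real"
  assumes f: "has_weak_deriv a b F f" and g: "has_weak_deriv a b G g"
  shows "(LBINT t:{a..b}. (f t + r * g t)\<^sup>2) =
    (LBINT t:{a..b}. (f t)\<^sup>2) + 2 * r * (LBINT t:{a..b}. f t * g t) + r\<^sup>2 * (LBINT t:{a..b}. (g t)\<^sup>2)"
proof -
  note f = has_weak_derivD(1,2)[OF f] and g = has_weak_derivD(1,2)[OF g]
  have i: "set_integrable lborel {a..b} (\<lambda>t. (2 * r) * (f t * g t))"
    by (intro set_integrable_mult_right set_integrable_mult_square f g)
  have i2: "set_integrable lborel {a..b} (\<lambda>t. r\<^sup>2 * (g t)\<^sup>2)"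
    by (intro set_integrable_mult_right g)
  have "(\<lambda>t. (f t + r * g t)\<^sup>2) = (\<lambda>t. ((f t)\<^sup>2 + (2 * r) * (f t * g t)) + r\<^sup>2 * (g t)\<^sup>2)"
    by (rule ext) (simp add: power2_eq_square algebra_simps)
  then have "(LBINT t:{a..b}. (f t + r * g t)\<^sup>2) =
    (LBINT t:{a..b}. ((f t)\<^sup>2 + (2 * r) * (f t * g t)) + r\<^sup>2 * (g t)\<^sup>2)" by (simp only:)
  also have "\<dots> = (LBINT t:{a..b}. (f t)\<^sup>2 + (2 * r) * (f t * g t)) + (LBINT t:{a..b}. r\<^sup>2 * (g t)\<^sup>2)"
    by (rule set_integral_add(2)[OF set_integral_add(1)[OF f(2) i] i2])
  also have "(LBINT t:{a..b}. (f t)\<^sup>2 + (2 * r) * (f t * g t)) =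
      (LBINT t:{a..b}. (f t)\<^sup>2) + (LBINT t:{a..b}. (2 * r) * (f t * g t))"
    by (rule set_integral_add(2)[OF f(2) i])
  finally show ?thesis
    by (simp only: set_integral_mult_right)
qed

text \<open>Along a line the kinetic part is a quadratic polynomial in \<open>r\<close> over an
  affine function. The remaining dependence on \<open>r\<close> is inside an integral of continuous
  functions, where the Leibniz rule applies.\<close>

lemma free_time_action_along_line:
  assumes x: "has_weak_deriv 0 l x x'" and v: "has_weak_deriv 0 l v g" and T: "\<Theta> + r * \<tau> \<noteq> 0"
  shows "free_time_action l k ((x, \<Theta>) + r *\<^sub>R (v, \<tau>)) =
    ((LBINT s:{0..l}. (x' s)\<^sup>2) + 2 * r * (LBINT s:{0..l}. x' s * g s) + r\<^sup>2 * (LBINT s:{0..l}. (g s)\<^sup>2))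
      / (2 * (\<Theta> + r * \<tau>))
    + (\<Theta> + r * \<tau>) * integral {0..l} (\<lambda>s. cos (x s + r * v s) - 1 + k)"
proof -
  define y where "y = (\<lambda>s. x s + r * v s)"
  define S where "S = \<Theta> + r * \<tau>"
  define w where "w = weak_deriv 0 l y"
  have y: "has_weak_deriv 0 l y (\<lambda>s. x' s + r * g s)"
    unfolding y_def by (rule has_weak_deriv_add_scaled[OF x v])
  have w: "has_weak_deriv 0 l y w"
    unfolding w_def weak_deriv_def using someI[of "has_weak_deriv 0 l y", OF y] .
  have c: "continuous_on {0..l} (\<lambda>s. cos (y s) - 1 + k)"
    by (intro continuous_intros has_weak_deriv_continuous_on[OF y])
  have ci: "set_integrable lborel {0..l} (\<lambda>s. cos (y s) - 1 + k)"
    by (rule borel_integrable_atLeastAtMost'[OF c])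
  have wi: "set_integrable lborel {0..l} (\<lambda>s. (w s)\<^sup>2 / (2 * S\<^sup>2))"
    using has_weak_derivD(2)[OF w] by (rule set_integrable_divide)
  have "free_time_action l k ((x, \<Theta>) + r *\<^sub>R (v, \<tau>)) =
      S * (LBINT s:{0..l}. pendulum_L (y s) (w s / S) + k)"
    unfolding free_time_action_def w_def y_def S_def
    by (simp add: plus_fun_def scaleR_fun_def)
  also have "(\<lambda>s. pendulum_L (y s) (w s / S) + k) = (\<lambda>s. (w s)\<^sup>2 / (2 * S\<^sup>2) + (cos (y s) - 1 + k))"
    by (rule ext) (simp add: pendulum_L_def power_divide)
  also have "(LBINT s:{0..l}. (w s)\<^sup>2 / (2 * S\<^sup>2) + (cos (y s) - 1 + k)) =
      (LBINT s:{0..l}. (w s)\<^sup>2 / (2 * S\<^sup>2)) + (LBINT s:{0..l}. cos (y s) - 1 + k)"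
    by (rule set_integral_add(2)[OF wi ci])
  also have "(LBINT s:{0..l}. cos (y s) - 1 + k) = integral {0..l} (\<lambda>s. cos (y s) - 1 + k)"
    by (rule set_borel_integral_eq_integral(2)[OF ci])
  also have "(LBINT s:{0..l}. (w s)\<^sup>2 / (2 * S\<^sup>2)) = (LBINT s:{0..l}. (w s)\<^sup>2) / (2 * S\<^sup>2)"
    by (rule set_integral_divide_zero)
  also have "(LBINT s:{0..l}. (w s)\<^sup>2) = (LBINT s:{0..l}. (x' s + r * g s)\<^sup>2)"
    by (rule set_integral_cong_AE_set_integrable[OF has_weak_derivD(2)[OF w] has_weak_derivD(2)[OF y]])
      (use has_weak_deriv_unique[OF w y] in eventually_elim, simp)
  also note set_integral_add_scaled_square[OF x v]
  also have "S * (N / (2 * S\<^sup>2) + I) = N / (2 * S) + S * I" for N I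
    using T unfolding S_def[symmetric] by (simp add: field_simps power2_eq_square)
  finally show ?thesis
    unfolding S_def y_def .
qed

lemma has_derivative_integral_cos:
  fixes x v :: "real \<Rightarrow> real"
  assumes x: "continuous_on {0..l} x" and v: "continuous_on {0..l} v"
  shows "((\<lambda>r. integral {0..l} (\<lambda>s. cos (x s + r * v s) - 1 + k)) has_real_derivative
      integral {0..l} (\<lambda>s. - sin (x s + r * v s) * v s)) (at r)"
    and "((\<lambda>r. integral {0..l} (\<lambda>s. - sin (x s + r * v s) * v s)) has_real_derivative
      integral {0..l} (\<lambda>s. - cos (x s + r * v s) * v s * v s)) (at r)"
proof -
  have cx: "continuous_on (UNIV \<times> {0..l}) (\<lambda>z::real \<times> real. x (snd z))"
    and cv: "continuous_on (UNIV \<times> {0..l}) (\<lambda>z::real \<times> real. v (snd z))"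
    by (rule continuous_on_compose2[OF x] continuous_on_compose2[OF v];
        auto intro: continuous_on_snd continuous_on_id)+
  show "((\<lambda>r. integral {0..l} (\<lambda>s. cos (x s + r * v s) - 1 + k)) has_real_derivative
      integral {0..l} (\<lambda>s. - sin (x s + r * v s) * v s)) (at r)"
    unfolding box_real(2)[symmetric]
  proof (rule leibniz_rule_field_derivative[where U = UNIV])
    show "((\<lambda>r. cos (x s + r * v s) - 1 + k) has_real_derivative - sin (x s + r * v s) * v s) (at r within UNIV)" for r s
      by (auto intro!: derivative_eq_intros)
    show "(\<lambda>s. cos (x s + r * v s) - 1 + k) integrable_on cbox 0 l" for r
      by (intro integrable_continuous continuous_intros; simp add: x v)
    show "continuous_on (UNIV \<times> cbox 0 l) (\<lambda>(r, s). - sin (x s + r * v s) * v s)"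
      unfolding case_prod_unfold box_real by (intro continuous_intros cx cv)
  qed auto
  show "((\<lambda>r. integral {0..l} (\<lambda>s. - sin (x s + r * v s) * v s)) has_real_derivative
      integral {0..l} (\<lambda>s. - cos (x s + r * v s) * v s * v s)) (at r)"
    unfolding box_real(2)[symmetric]
  proof (rule leibniz_rule_field_derivative[where U = UNIV])
    show "((\<lambda>r. - sin (x s + r * v s) * v s) has_real_derivative - cos (x s + r * v s) * v s * v s) (at r within UNIV)" for r s
      by (auto intro!: derivative_eq_intros)
    show "(\<lambda>s. - sin (x s + r * v s) * v s) integrable_on cbox 0 l" for r
      by (intro integrable_continuous continuous_intros; simp add: x v)
    show "continuous_on (UNIV \<times> cbox 0 l) (\<lambda>(r, s). - cos (x s + r * v s) * v s * v s)"
      unfolding case_prod_unfold box_real by (intro continuous_intros cx cv)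
  qed auto
qed

text \<open>\<open>D\<close> is found by differentiating the formula along the line. The value of
  \<open>D 0\<close> for \<open>\<tau> = 0\<close> is the first variation at fixed period; it serves
  later to show that the orbit is critical in the direction used against minimality.\<close>

lemma free_time_action_second_variation:
  assumes x: "has_weak_deriv 0 l x x'" and v: "has_weak_deriv 0 l v g" and T: "\<Theta> > 0"
  obtains D where
    "\<forall>\<^sub>F r in nhds 0. ((\<lambda>r. free_time_action l k ((x, \<Theta>) + r *\<^sub>R (v, \<tau>))) has_real_derivative D r) (at r)"
    and "(D has_real_derivative (LBINT s:{0..l}. (g s - \<tau> / \<Theta> * x' s)\<^sup>2 / \<Theta>
          - 2 * \<tau> * v s * sin (x s) - \<Theta> * cos (x s) * (v s)\<^sup>2)) (at 0)"
    and "\<tau> = 0 \<longrightarrow> D 0 = (LBINT s:{0..l}. x' s * g s) / \<Theta> - \<Theta> * (LBINT s:{0..l}. v s * sin (x s))"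
proof -
  define A where "A = (LBINT s:{0..l}. (x' s)\<^sup>2)"
  define B where "B = (LBINT s:{0..l}. x' s * g s)"
  define C where "C = (LBINT s:{0..l}. (g s)\<^sup>2)"
  define W where "W = (\<lambda>r. integral {0..l} (\<lambda>s. cos (x s + r * v s) - 1 + k))"
  define W1 where "W1 = (\<lambda>r. integral {0..l} (\<lambda>s. - sin (x s + r * v s) * v s))"
  define W2 where "W2 = (\<lambda>r. integral {0..l} (\<lambda>s. - cos (x s + r * v s) * v s * v s))"
  have cx: "continuous_on {0..l} x" and cv: "continuous_on {0..l} v"
    using x v has_weak_deriv_continuous_on by blast+
  have dW: "(W has_real_derivative W1 r) (at r)" "(W1 has_real_derivative W2 r) (at r)" for r
    unfolding W_def W1_def W2_def by (rule has_derivative_integral_cos[OF cx cv])+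
  define D where "D = (\<lambda>r. (2 * B + 2 * r * C) / (2 * (\<Theta> + r * \<tau>))
      - (A + 2 * r * B + r\<^sup>2 * C) * \<tau> / (2 * (\<Theta> + r * \<tau>)\<^sup>2) + \<tau> * W r + (\<Theta> + r * \<tau>) * W1 r)"
  have "((\<lambda>r. \<Theta> + r * \<tau>) \<longlongrightarrow> \<Theta> + 0 * \<tau>) (nhds 0)"
    by (intro tendsto_intros filterlim_ident)
  then have pos: "\<forall>\<^sub>F r in nhds 0. \<Theta> + r * \<tau> > 0"
    using T by (auto dest: order_tendstoD)
  \<comment> \<open>Differentiating at \<open>r\<close> uses the formula on a neighbourhood of
    \<open>r\<close>, hence the nested eventuality.\<close>
  then have "\<forall>\<^sub>F r in nhds 0. \<forall>\<^sub>F r' in nhds r. \<Theta> + r' * \<tau> > 0"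
    by (simp add: eventually_eventually)
  then have 1: "\<forall>\<^sub>F r in nhds 0. ((\<lambda>r. free_time_action l k ((x, \<Theta>) + r *\<^sub>R (v, \<tau>))) has_real_derivative D r) (at r)"
  proof eventually_elim
    case (elim r)
    have r: "\<Theta> + r * \<tau> > 0" using eventually_nhds_x_imp_x[OF elim] .
    have quot: "(a * (2 * S) - b * (2 * \<tau>)) / ((2 * S) * (2 * S)) = a / (2 * S) - b * \<tau> / (2 * S\<^sup>2)"
      if "S > 0" for a b S :: real
      using that by (simp add: field_simps power2_eq_square)
    have "((\<lambda>r. A + 2 * r * B + r\<^sup>2 * C) has_real_derivative (2 * B + 2 * r * C)) (at r)"
      by (auto intro!: derivative_eq_intros)
    moreover have "((\<lambda>r. 2 * (\<Theta> + r * \<tau>)) has_real_derivative 2 * \<tau>) (at r)"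
      by (auto intro!: derivative_eq_intros)
    ultimately have "((\<lambda>r. (A + 2 * r * B + r\<^sup>2 * C) / (2 * (\<Theta> + r * \<tau>))) has_real_derivative
        (2 * B + 2 * r * C) / (2 * (\<Theta> + r * \<tau>)) - (A + 2 * r * B + r\<^sup>2 * C) * \<tau> / (2 * (\<Theta> + r * \<tau>)\<^sup>2)) (at r)"
      unfolding quot[OF r, symmetric] by (rule DERIV_divide) (use r in simp)
    moreover have "((\<lambda>r. (\<Theta> + r * \<tau>) * W r) has_real_derivative \<tau> * W r + (\<Theta> + r * \<tau>) * W1 r) (at r)"
      by (auto intro!: derivative_eq_intros dW)
    ultimately have "((\<lambda>r. (A + 2 * r * B + r\<^sup>2 * C) / (2 * (\<Theta> + r * \<tau>)) + (\<Theta> + r * \<tau>) * W r) has_real_derivative D r) (at r)"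
      unfolding D_def add.assoc by (rule DERIV_add)
    moreover have "\<forall>\<^sub>F r' in nhds r. free_time_action l k ((x, \<Theta>) + r' *\<^sub>R (v, \<tau>)) =
        (A + 2 * r' * B + r'\<^sup>2 * C) / (2 * (\<Theta> + r' * \<tau>)) + (\<Theta> + r' * \<tau>) * W r'"
      using elim
    proof eventually_elim
      case (elim r')
      then show ?case
        using free_time_action_along_line[OF x v, of \<Theta> r' \<tau> k] unfolding A_def B_def C_def W_def by simp
    qed
    ultimately show ?case by (subst DERIV_cong_ev[OF refl _ refl]) auto
  qed
  \<comment> \<open>In terms of \<open>\<sigma>\<close> the kinetic contribution becomes
    \<open>C - 2 * B * \<sigma> + A * \<sigma>\<^sup>2\<close> over \<open>\<Theta>\<close>, the
    expanded integral of the square of \<open>g - \<sigma> * x'\<close>.\<close>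
  define \<sigma> where "\<sigma> = \<tau> / \<Theta>"
  have tau: "\<tau> = \<sigma> * \<Theta>" using T by (simp add: \<sigma>_def)
  have "(D has_real_derivative (C - 2 * B * \<sigma> + A * \<sigma>\<^sup>2) / \<Theta> + 2 * \<tau> * W1 0 + \<Theta> * W2 0) (at 0)"
  proof -
    have d1: "((\<lambda>r. (2 * B + 2 * r * C) / (2 * (\<Theta> + r * \<tau>))) has_real_derivative (C - B * \<sigma>) / \<Theta>) (at 0)"
      unfolding tau using T by (auto intro!: derivative_eq_intros simp: field_simps)
    have d2: "((\<lambda>r. (A + 2 * r * B + r\<^sup>2 * C) * \<tau> / (2 * (\<Theta> + r * \<tau>)\<^sup>2)) has_real_derivative
        (B * \<sigma> - A * \<sigma>\<^sup>2) / \<Theta>) (at 0)"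
      unfolding tau using T
      by (auto intro!: derivative_eq_intros simp: divide_simps) (auto simp: algebra_simps power2_eq_square power4_eq_xxxx)
    have d3: "((\<lambda>r. \<tau> * W r + (\<Theta> + r * \<tau>) * W1 r) has_real_derivative 2 * \<tau> * W1 0 + \<Theta> * W2 0) (at 0)"
      by (auto intro!: derivative_eq_intros dW)
    have "(C - 2 * B * \<sigma> + A * \<sigma>\<^sup>2) / \<Theta> + 2 * \<tau> * W1 0 + \<Theta> * W2 0 =
        (C - B * \<sigma>) / \<Theta> - (B * \<sigma> - A * \<sigma>\<^sup>2) / \<Theta> + (2 * \<tau> * W1 0 + \<Theta> * W2 0)"
      by (simp add: diff_divide_distrib add_divide_distrib)
    then show ?thesis
      unfolding D_def add.assoc using DERIV_add[OF DERIV_diff[OF d1 d2] d3] by (simp only: add.assoc)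
  qed
  moreover have "(C - 2 * B * \<sigma> + A * \<sigma>\<^sup>2) / \<Theta> + 2 * \<tau> * W1 0 + \<Theta> * W2 0 =
     (LBINT s:{0..l}. (g s - \<tau> / \<Theta> * x' s)\<^sup>2 / \<Theta> - 2 * \<tau> * v s * sin (x s) - \<Theta> * cos (x s) * (v s)\<^sup>2)"
  proof -
    have i1: "set_integrable lborel {0..l} (\<lambda>s. (g s + (- \<sigma>) * x' s)\<^sup>2)"
      using has_weak_derivD(2)[OF has_weak_deriv_add_scaled[OF v x]] .
    have i1': "set_integrable lborel {0..l} (\<lambda>s. (g s + (- \<sigma>) * x' s)\<^sup>2 / \<Theta>)"
      using i1 by (rule set_integrable_divide)
    have i2: "set_integrable lborel {0..l} (\<lambda>s. - sin (x s + 0 * v s) * v s)"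
      by (intro borel_integrable_atLeastAtMost' continuous_intros cx cv)
    have i2': "set_integrable lborel {0..l} (\<lambda>s. (2 * \<tau>) * (- sin (x s + 0 * v s) * v s))"
      using i2 by (rule set_integrable_mult_right)
    have i3: "set_integrable lborel {0..l} (\<lambda>s. - cos (x s + 0 * v s) * v s * v s)"
      by (intro borel_integrable_atLeastAtMost' continuous_intros cx cv)
    have i3': "set_integrable lborel {0..l} (\<lambda>s. \<Theta> * (- cos (x s + 0 * v s) * v s * v s))"
      using i3 by (rule set_integrable_mult_right)
    have "(\<lambda>s. (g s - \<tau> / \<Theta> * x' s)\<^sup>2 / \<Theta> - 2 * \<tau> * v s * sin (x s) - \<Theta> * cos (x s) * (v s)\<^sup>2) =
      (\<lambda>s. ((g s + (- \<sigma>) * x' s)\<^sup>2 / \<Theta> + (2 * \<tau>) * (- sin (x s + 0 * v s) * v s))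
        + \<Theta> * (- cos (x s + 0 * v s) * v s * v s))"
      by (rule ext) (simp add: \<sigma>_def power2_eq_square)
    then have "(LBINT s:{0..l}. (g s - \<tau> / \<Theta> * x' s)\<^sup>2 / \<Theta> - 2 * \<tau> * v s * sin (x s) - \<Theta> * cos (x s) * (v s)\<^sup>2)
      = (LBINT s:{0..l}. ((g s + (- \<sigma>) * x' s)\<^sup>2 / \<Theta> + (2 * \<tau>) * (- sin (x s + 0 * v s) * v s))
        + \<Theta> * (- cos (x s + 0 * v s) * v s * v s))" by (simp only:)
    also have "\<dots> = (LBINT s:{0..l}. (g s + (- \<sigma>) * x' s)\<^sup>2 / \<Theta> + (2 * \<tau>) * (- sin (x s + 0 * v s) * v s))
        + (LBINT s:{0..l}. \<Theta> * (- cos (x s + 0 * v s) * v s * v s))"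
      by (rule set_integral_add(2)[OF set_integral_add(1)[OF i1' i2'] i3'])
    also have "(LBINT s:{0..l}. (g s + (- \<sigma>) * x' s)\<^sup>2 / \<Theta> + (2 * \<tau>) * (- sin (x s + 0 * v s) * v s)) =
       (LBINT s:{0..l}. (g s + (- \<sigma>) * x' s)\<^sup>2 / \<Theta>) + (LBINT s:{0..l}. (2 * \<tau>) * (- sin (x s + 0 * v s) * v s))"
      by (rule set_integral_add(2)[OF i1' i2'])
    also have "(LBINT s:{0..l}. (g s + (- \<sigma>) * x' s)\<^sup>2 / \<Theta>) = (LBINT s:{0..l}. (g s + (- \<sigma>) * x' s)\<^sup>2) / \<Theta>"
      by (rule set_integral_divide_zero)
    also have "(LBINT s:{0..l}. (2 * \<tau>) * (- sin (x s + 0 * v s) * v s)) = 2 * \<tau> * W1 0"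
      unfolding set_integral_mult_right W1_def by (simp only: set_borel_integral_eq_integral(2)[OF i2])
    also have "(LBINT s:{0..l}. \<Theta> * (- cos (x s + 0 * v s) * v s * v s)) = \<Theta> * W2 0"
      unfolding set_integral_mult_right W2_def by (simp only: set_borel_integral_eq_integral(2)[OF i3])
    also have "(LBINT s:{0..l}. (g s + (- \<sigma>) * x' s)\<^sup>2) = C + 2 * (- \<sigma>) * B + (- \<sigma>)\<^sup>2 * A"
      unfolding set_integral_add_scaled_square[OF v x] A_def B_def C_def by (simp only: mult.commute)
    finally show ?thesis by (simp add: algebra_simps)
  qed
  ultimately have 2: "(D has_real_derivative (LBINT s:{0..l}. (g s - \<tau> / \<Theta> * x' s)\<^sup>2 / \<Theta>
      - 2 * \<tau> * v s * sin (x s) - \<Theta> * cos (x s) * (v s)\<^sup>2)) (at 0)" by (simp only:)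
  have 3: "\<tau> = 0 \<longrightarrow> D 0 = B / \<Theta> - \<Theta> * (LBINT s:{0..l}. v s * sin (x s))"
  proof
    assume "\<tau> = 0"
    have i: "set_integrable lborel {0..l} (\<lambda>s. v s * sin (x s))"
      by (intro borel_integrable_atLeastAtMost' continuous_intros cx cv)
    have "W1 0 = - integral {0..l} (\<lambda>s. v s * sin (x s))"
      unfolding W1_def by (simp add: mult.commute)
    then show "D 0 = B / \<Theta> - \<Theta> * (LBINT s:{0..l}. v s * sin (x s))"
      unfolding D_def \<open>\<tau> = 0\<close> set_borel_integral_eq_integral(2)[OF i] by simp
  qed
  show thesis using that[OF 1 2 3[unfolded B_def]] .
qed

section \<open>Nonnegativity on a subspace of codimension one\<close>

lemma set_integral_Icc_refl: "(LBINT s:{a..a}. f s) = (0::real)" for a :: real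
proof -
  have "AE s in lborel. indicator {a..a} s *\<^sub>R f s = 0"
    using AE_lborel_singleton[of a] by eventually_elim simp
  then show ?thesis unfolding set_lebesgue_integral_def by (rule integral_eq_zero_AE)
qed

lemma has_L1_deriv_integral:
  "set_integrable lborel {a..b} g \<Longrightarrow> has_L1_deriv a b (\<lambda>t. LBINT s:{a..t}. g s) g"
  unfolding has_L1_deriv_def set_integral_Icc_refl by simp

text \<open>Cauchy-Schwarz for the integral of \<open>g\<close> over \<open>[s, t]\<close>. The
  right side is written with the indefinite integral of \<open>g\<^sup>2\<close>, whose continuity
  later yields more than Hoelder continuity of order 1/2.\<close>

lemma has_weak_deriv_square_bound:
  assumes u: "has_weak_deriv a b u g" and st: "a \<le> s" "s \<le> t" "t \<le> b"
  shows "(u t - u s)\<^sup>2 \<le> (t - s) * ((LBINT x:{a..t}. (g x)\<^sup>2) - (LBINT x:{a..s}. (g x)\<^sup>2))"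
proof (cases "s = t")
  case False
  then have lt: "s < t" using st by simp
  have g2: "set_integrable lborel {a..t} (\<lambda>x. (g x)\<^sup>2)"
    by (rule set_integrable_subset[OF has_weak_derivD(2)[OF u]]) (use st in auto)
  have g2': "set_integrable lborel {s..t} (\<lambda>x. (g x)\<^sup>2)"
    by (rule set_integrable_subset[OF g2]) (use st in auto)
  have g1: "set_integrable lborel {s..t} g"
    by (rule set_integrable_subset[OF has_weak_deriv_set_integrable[OF u]]) (use st in auto)
  define I where "I = (LBINT x:{s..t}. (g x)\<^sup>2)"
  have I: "(LBINT x:{a..t}. (g x)\<^sup>2) - (LBINT x:{a..s}. (g x)\<^sup>2) = I"
    unfolding I_def using set_integral_Icc_combine[OF g2 st(1,2)] by simp
  have diff: "u t - u s = (LBINT x:{s..t}. g x)"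
    by (rule has_L1_deriv_diff[OF has_weak_deriv_imp_has_L1_deriv[OF u] st])
  \<comment> \<open>The mean of \<open>g\<close> over \<open>[s, t]\<close>: integrating
    \<open>g\<^sup>2 \<ge> 2 * \<mu> * g - \<mu>\<^sup>2\<close> with this constant gives the sharp
    bound.\<close>
  define \<mu> where "\<mu> = (u t - u s) / (t - s)"
  have i1: "set_integrable lborel {s..t} (\<lambda>x. (2 * \<mu>) * g x)"
    using g1 by (rule set_integrable_mult_right)
  have i2: "set_integrable lborel {s..t} (\<lambda>x. (2 * \<mu>) * g x - \<mu>\<^sup>2)"
    by (intro set_integral_diff(1)[OF i1] borel_integrable_atLeastAtMost' continuous_on_const)
  have "(LBINT x:{s..t}. (2 * \<mu>) * g x - \<mu>\<^sup>2) \<le> I"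
    unfolding I_def
  proof (rule set_integral_mono[OF i2 g2'])
    fix x show "2 * \<mu> * g x - \<mu>\<^sup>2 \<le> (g x)\<^sup>2"
      using zero_le_power2[of "g x - \<mu>"] by (simp add: power2_eq_square algebra_simps)
  qed
  moreover have "(LBINT x:{s..t}. (2 * \<mu>) * g x - \<mu>\<^sup>2) = (2 * \<mu>) * (u t - u s) - \<mu>\<^sup>2 * (t - s)"
  proof -
    have "(LBINT x:{s..t}. (2 * \<mu>) * g x - \<mu>\<^sup>2) = (LBINT x:{s..t}. (2 * \<mu>) * g x) - (LBINT x:{s..t}. \<mu>\<^sup>2)"
      by (rule set_integral_diff(2)[OF i1]) (intro borel_integrable_atLeastAtMost' continuous_on_const)
    moreover have "(LBINT x:{s..t}. \<mu>\<^sup>2) = \<mu>\<^sup>2 * (t - s)"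
      using lt by (simp add: set_lebesgue_integral_def)
    ultimately show ?thesis unfolding diff by simp
  qed
  moreover have "(2 * \<mu>) * (u t - u s) - \<mu>\<^sup>2 * (t - s) = (u t - u s)\<^sup>2 / (t - s)"
  proof -
    have key: "(2 * (d / L)) * d - (d / L)\<^sup>2 * L = d\<^sup>2 / L" if "L > 0" for d L :: real
      using that by (simp add: field_simps power2_eq_square)
    show ?thesis unfolding \<mu>_def by (rule key) (use lt in simp)
  qed
  ultimately have "(u t - u s)\<^sup>2 / (t - s) \<le> I" by linarith
  then show ?thesis unfolding I using lt by (simp add: pos_divide_le_eq mult.commute)
qed simp

text \<open>Continuity carries monotonicity to the end points; the end points of interest are the
  poles of the logarithmic derivative below.\<close>

lemma continuous_on_mono_open_imp_le:
  fixes f :: "real \<Rightarrow> real"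
  assumes ab: "a < b" and f: "continuous_on {a..b} f"
    and mono: "\<And>s t. a < s \<Longrightarrow> s \<le> t \<Longrightarrow> t < b \<Longrightarrow> f s \<le> f t"
  shows "f a \<le> f b"
proof -
  define m where "m = (a + b) / 2"
  have m: "a < m" "m < b" using ab unfolding m_def by auto
  have "f a \<le> f m"
  proof (rule tendsto_upperbound)
    show "(f \<longlongrightarrow> f a) (at_right a)"
      using f ab by (auto simp: continuous_on_Icc_at_rightD)
    show "\<forall>\<^sub>F x in at_right a. f x \<le> f m"
      unfolding eventually_at_right_field using m mono by (intro exI[of _ m]) auto
  qed simp
  moreover have "f m \<le> f b"
  proof (rule tendsto_lowerbound)
    show "(f \<longlongrightarrow> f b) (at_left b)"
      using f ab by (auto simp: continuous_on_Icc_at_leftD)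
    show "\<forall>\<^sub>F x in at_left b. f m \<le> f x"
      unfolding eventually_at_left_field using m mono by (intro exI[of _ m]) auto
  qed simp
  ultimately show ?thesis by simp
qed

text \<open>The time scale \<open>c\<close> lets one treat both functionals at once: \<open>c = 1\<close>, \<open>l = T\<close> for the fixed-time
  action and \<open>c = T\<close>, \<open>l = 1\<close> for the free-time functional.\<close>

locale scaled_libration =
  fixes c l k :: real and X P :: "real \<Rightarrow> real"
  assumes c: "0 < c" and l: "0 < l" and k: "0 < k" "k < 2"
    and dX: "\<And>s. (X has_real_derivative c * P s) (at s)"
    and dP: "\<And>s. (P has_real_derivative - c * sin (X s)) (at s)"
    and energy: "\<And>s. (P s)\<^sup>2 / 2 + (1 - cos (X s)) = k"
    and periodic: "\<And>s. X (s + l) = X s"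
    and P_ends: "P 0 = 0" "P l = 0"
    and half: "P (l / 2) = 0" "X (l / 2) = - X 0" and X_0: "0 < X 0" "X 0 < pi"
    and X_zeros: "X (l / 4) = 0" "X (3 * l / 4) = 0" "P (3 * l / 4) = - P (l / 4)"
    and sin_half_nonzero: "\<And>s. 0 \<le> s \<Longrightarrow> s \<le> l \<Longrightarrow> s \<noteq> l / 4 \<Longrightarrow> s \<noteq> 3 * l / 4 \<Longrightarrow> sin (X s / 2) \<noteq> 0"
begin

lemma X_l: "X l = X 0"
  using periodic[of 0] by simp

lemma continuous_X: "continuous_on A X" and continuous_P: "continuous_on A P"
  by (rule DERIV_continuous_on, rule has_field_derivative_at_within, rule dX dP)+

lemma weak_deriv_X: "has_weak_deriv a b X (\<lambda>s. c * P s)"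
  by (rule has_weak_deriv_C1[OF dX]) (intro continuous_intros continuous_P)

lemma weak_deriv_P: "has_weak_deriv a b P (\<lambda>s. - c * sin (X s))"
  by (rule has_weak_deriv_C1[OF dP]) (intro continuous_intros continuous_X)

lemma cos_X: "cos (X s) = 1 - 2 * (sin (X s / 2))\<^sup>2"
  using cos_double_sin[of "X s / 2"] by simp

lemma sin_X: "sin (X s) = 2 * sin (X s / 2) * cos (X s / 2)"
  using sin_double[of "X s / 2"] by simp

lemma P_square: "(P s)\<^sup>2 = 2 * k - 4 * (sin (X s / 2))\<^sup>2"
  using energy[of s] unfolding cos_X by simp

text \<open>The integrand of the second variation at fixed period. The derivative \<open>g\<close>
  is a separate argument because a weak derivative is only determined almost everywhere.\<close>

definition quad :: "(real \<Rightarrow> real) \<Rightarrow> (real \<Rightarrow> real) \<Rightarrow> real \<Rightarrow> real"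
  where "quad v g s = (g s)\<^sup>2 / c - c * cos (X s) * (v s)\<^sup>2"

lemma quad_set_integrable:
  assumes "has_weak_deriv a b v g"
  shows "set_integrable lborel {a..b} (quad v g)"
  unfolding quad_def
  by (intro set_integral_diff(1) set_integrable_divide has_weak_derivD(2)[OF assms]
      borel_integrable_atLeastAtMost' continuous_intros continuous_X has_weak_deriv_continuous_on[OF assms])

section \<open>Riccati substitution with the eigenfunction \<open>sin (X / 2)\<close>\<close>

text \<open>The logarithmic derivative of the solution \<open>y = sin (X / 2)\<close> of
  \<open>- y'' - c\<^sup>2 cos X y = c\<^sup>2 (k / 2) y\<close>. At the zeros of \<open>X\<close> it takes the junk value \<open>0\<close>.\<close>

definition slope :: "real \<Rightarrow> real"
  where "slope s = c * P s * cos (X s / 2) / (2 * sin (X s / 2))"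

text \<open>The Riccati equation belonging to the linear equation for \<open>sin (X / 2)\<close>;
  conservation of energy turns \<open>C\<^sup>2 + (P s)\<^sup>2 / 4\<close> into
  \<open>k / 2 + cos (X s)\<close>.\<close>

lemma slope_deriv:
  assumes "sin (X s / 2) \<noteq> 0"
  shows "(slope has_real_derivative - (slope s)\<^sup>2 - c\<^sup>2 * (k / 2 + cos (X s))) (at s)"
proof -
  define S where "S = sin (X s / 2)"
  define C where "C = cos (X s / 2)"
  have S: "S \<noteq> 0" using assms S_def by simp
  have SC: "C\<^sup>2 = 1 - S\<^sup>2" unfolding S_def C_def by (simp add: cos_squared_eq)
  have dS: "((\<lambda>s. 2 * sin (X s / 2)) has_real_derivative c * P s * C) (at s)"
    unfolding C_def by (auto intro!: derivative_eq_intros dX)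
  have dN: "((\<lambda>s. c * P s * cos (X s / 2)) has_real_derivative
      - c * c * (2 * S * C) * C - c * c * (P s)\<^sup>2 * S / 2) (at s)"
    unfolding S_def C_def sin_X[symmetric]
    by (auto intro!: derivative_eq_intros dX dP simp: power2_eq_square)
  have "(slope has_real_derivative ((- c * c * (2 * S * C) * C - c * c * (P s)\<^sup>2 * S / 2) * (2 * S)
      - c * P s * C * (c * P s * C)) / ((2 * S) * (2 * S))) (at s)"
    unfolding slope_def using DERIV_divide[OF dN dS] S unfolding S_def C_def by simp
  moreover have "((- c * c * (2 * S * C) * C - c * c * (P s)\<^sup>2 * S / 2) * (2 * S)
      - c * P s * C * (c * P s * C)) / ((2 * S) * (2 * S)) =
      - (c * P s * C / (2 * S))\<^sup>2 - c\<^sup>2 * (C\<^sup>2 + (P s)\<^sup>2 / 4)"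
    using S by (simp add: field_simps power2_eq_square)
  moreover have "C\<^sup>2 + (P s)\<^sup>2 / 4 = k / 2 + cos (X s)"
    unfolding SC P_square cos_X S_def by (simp add: field_simps)
  ultimately show ?thesis unfolding slope_def S_def C_def by simp
qed

text \<open>Completing the square: subtracting the derivative of
  \<open>slope * u\<^sup>2 / c\<close> from \<open>quad u g\<close> leaves
  \<open>(g - slope * u)\<^sup>2 / c\<close> plus \<open>c * (k / 2) * u\<^sup>2\<close>, the
  contribution of the positive eigenvalue.\<close>

lemma quad_ge_boundary_terms:
  assumes u: "has_weak_deriv 0 l u g" and ab: "0 \<le> a" "a \<le> b" "b \<le> l"
    and nz: "\<And>s. a \<le> s \<Longrightarrow> s \<le> b \<Longrightarrow> sin (X s / 2) \<noteq> 0"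
  shows "(slope b * (u b)\<^sup>2 - slope a * (u a)\<^sup>2) / c \<le> (LBINT s:{a..b}. quad u g s)"
proof -
  define f where "f = (\<lambda>s. - (slope s)\<^sup>2 - c\<^sup>2 * (k / 2 + cos (X s)))"
  have u1: "has_L1_deriv a b u g"
    by (rule has_L1_deriv_subinterval[OF has_weak_deriv_imp_has_L1_deriv[OF u]]) (use ab in auto)
  have "continuous_on {a..b} slope"
    by (rule DERIV_continuous_on, rule has_field_derivative_at_within, rule slope_deriv) (use nz in auto)
  then have "continuous_on {a..b} f"
    unfolding f_def by (intro continuous_intros continuous_X)
  then have "has_weak_deriv a b slope f"
    by (intro has_weak_deriv_C1) (use slope_deriv nz in \<open>auto simp: f_def\<close>)
  then have s1: "has_L1_deriv a b slope f" by (rule has_weak_deriv_imp_has_L1_deriv)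
  define h where "h = (\<lambda>s. f s * (u s * u s) + slope s * (g s * u s + u s * g s))"
  have h: "has_L1_deriv a b (\<lambda>s. slope s * (u s * u s)) h"
    unfolding h_def by (rule has_L1_deriv_mult[OF s1 has_L1_deriv_mult[OF u1 u1]])
  have hi: "set_integrable lborel {a..b} (\<lambda>s. h s / c)"
    using has_L1_derivD(1)[OF h] by (rule set_integrable_divide)
  have "(slope b * (u b)\<^sup>2 - slope a * (u a)\<^sup>2) / c = (LBINT s:{a..b}. h s / c)"
    using has_L1_deriv_diff[OF h, of a b] ab by (simp add: power2_eq_square)
  also have "\<dots> \<le> (LBINT s:{a..b}. quad u g s)"
  proof (rule set_integral_mono[OF hi])
    show "set_integrable lborel {a..b} (quad u g)"
      by (rule set_integrable_subset[OF quad_set_integrable[OF u]]) (use ab in auto)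
    fix s
    have "quad u g s - h s / c = (g s - slope s * u s)\<^sup>2 / c + c * (k / 2) * (u s)\<^sup>2"
      unfolding quad_def h_def f_def using c by (simp add: field_simps power2_eq_square)
    also have "\<dots> \<ge> 0" using c k by simp
    finally show "h s / c \<le> quad u g s" by simp
  qed
  finally show ?thesis .
qed

text \<open>At a zero of \<open>X\<close> the energy relation gives \<open>P t \<noteq> 0\<close>,
  so \<open>sin (X / 2)\<close> has a simple zero there and its logarithmic derivative a simple pole
  with residue 1.\<close>

lemma slope_asymp:
  assumes "X t = 0"
  shows "((\<lambda>s. slope s * (s - t)) \<longlongrightarrow> 1) (at t)"
proof -
  have P: "P t \<noteq> 0" using P_square[of t] assms k by auto
  have "((\<lambda>s. sin (X s / 2)) has_real_derivative c * P t / 2) (at t)"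
    using assms by (auto intro!: derivative_eq_intros dX)
  then have lim1: "((\<lambda>s. sin (X s / 2) / (s - t)) \<longlongrightarrow> c * P t / 2) (at t)"
    using assms by (simp add: has_field_derivative_iff)
  have lim2: "((\<lambda>s. c * P s * cos (X s / 2) / 2) \<longlongrightarrow> c * P t * cos (X t / 2) / 2) (at t)"
    using dX[of t] dP[of t] by (intro tendsto_intros) (auto dest!: DERIV_isCont simp: isCont_def)
  have "((\<lambda>s. (c * P s * cos (X s / 2) / 2) / (sin (X s / 2) / (s - t))) \<longlongrightarrow>
      (c * P t * cos (X t / 2) / 2) / (c * P t / 2)) (at t)"
    by (rule tendsto_divide[OF lim2 lim1]) (use P c in auto)
  moreover have "(\<lambda>s. (c * P s * cos (X s / 2) / 2) / (sin (X s / 2) / (s - t))) = (\<lambda>s. slope s * (s - t))"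
    by (rule ext) (simp add: slope_def)
  ultimately show ?thesis using P c assms by simp
qed

text \<open>At a pole \<open>t\<close> of \<open>slope\<close> the function \<open>u\<close>
  vanishes, and \<open>u\<^sup>2\<close> is of smaller order than the distance to \<open>t\<close>,
  which beats a simple pole. The limit 0 agrees with the value at \<open>t\<close>, where
  \<open>u t = 0\<close>.\<close>

lemma continuous_on_slope_mult_square:
  assumes u: "has_weak_deriv 0 l u g" and z: "u (l / 4) = 0" "u (3 * l / 4) = 0"
  shows "continuous_on {0..l} (\<lambda>s. slope s * (u s)\<^sup>2)"
  unfolding continuous_on_def
proof
  fix t assume t: "t \<in> {0..l}"
  have cu: "(u \<longlongrightarrow> u t) (at t within {0..l})"
    using has_weak_deriv_continuous_on[OF u] t by (simp add: continuous_on_def)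
  show "((\<lambda>s. slope s * (u s)\<^sup>2) \<longlongrightarrow> slope t * (u t)\<^sup>2) (at t within {0..l})"
  proof (cases "sin (X t / 2) = 0")
    case False
    have "(slope \<longlongrightarrow> slope t) (at t within {0..l})"
      using DERIV_isCont[OF slope_deriv[OF False]] unfolding isCont_def by (rule tendsto_within_subset) simp
    then show ?thesis by (intro tendsto_intros cu)
  next
    case True
    then have tz: "t = l / 4 \<or> t = 3 * l / 4" using sin_half_nonzero t by auto
    then have ut: "u t = 0" and Xt: "X t = 0" using z X_zeros(1,2) by blast+
    \<comment> \<open>A bound of \<open>u\<^sup>2\<close> by a constant times the distance would
      only give boundedness near the pole; continuity of \<open>K\<close> supplies the factor
      tending to 0.\<close>
    define K where "K = (\<lambda>s. LBINT x:{0..s}. (g x)\<^sup>2)"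
    have "continuous_on {0..l} K"
      unfolding K_def
      by (rule has_L1_deriv_continuous_on[OF has_L1_deriv_integral[OF has_weak_derivD(2)[OF u]]])
    then have "(K \<longlongrightarrow> K t) (at t within {0..l})" using t by (simp add: continuous_on_def)
    then have lim0: "((\<lambda>s. K s - K t) \<longlongrightarrow> 0) (at t within {0..l})"
      by (simp add: LIM_zero)
    have "((\<lambda>s. slope s * (s - t)) \<longlongrightarrow> 1) (at t within {0..l})"
      by (rule tendsto_within_subset[OF slope_asymp[OF Xt]]) auto
    from tendsto_mult[OF this lim0] have lim: "((\<lambda>s. \<bar>slope s * (s - t) * (K s - K t)\<bar>) \<longlongrightarrow> 0) (at t within {0..l})"
      by (intro tendsto_rabs_zero) simp
    have bound: "(u s)\<^sup>2 \<le> \<bar>(s - t) * (K s - K t)\<bar>" if s: "s \<in> {0..l}" for s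
    proof (cases "s \<le> t")
      case True
      then have "(u s)\<^sup>2 \<le> (t - s) * (K t - K s)"
        using has_weak_deriv_square_bound[OF u, of s t] s t ut unfolding K_def by simp
      also have "\<dots> = (s - t) * (K s - K t)" by (simp add: algebra_simps)
      finally show ?thesis by linarith
    next
      case False
      then have "(u s)\<^sup>2 \<le> (s - t) * (K s - K t)"
        using has_weak_deriv_square_bound[OF u, of t s] s t ut unfolding K_def by simp
      then show ?thesis by linarith
    qed
    have "((\<lambda>s. slope s * (u s)\<^sup>2) \<longlongrightarrow> 0) (at t within {0..l})"
    proof (rule Lim_null_comparison[OF _ lim])
      have "norm (slope s * (u s)\<^sup>2) \<le> \<bar>slope s * (s - t) * (K s - K t)\<bar>" if "s \<in> {0..l}" for s
        using mult_left_mono[OF bound[OF that], of "\<bar>slope s\<bar>"] by (simp add: abs_mult mult.assoc)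
      then show "\<forall>\<^sub>F s in at t within {0..l}. norm (slope s * (u s)\<^sup>2) \<le> \<bar>slope s * (s - t) * (K s - K t)\<bar>"
        by (auto simp: eventually_at_filter)
    qed
    then show ?thesis using ut by simp
  qed
qed

text \<open>The integral minus the boundary term, \<open>M\<close>, increases on each of the three
  intervals cut off by the zeros of \<open>X\<close> and is continuous across them. At 0 and
  \<open>l\<close> the boundary term vanishes since \<open>P\<close> does, so
  \<open>M 0 \<le> M l\<close> is the claim.\<close>

lemma quad_nonneg_vanishing:
  assumes u: "has_weak_deriv 0 l u g" and z: "u (l / 4) = 0" "u (3 * l / 4) = 0"
  shows "(LBINT s:{0..l}. quad u g s) \<ge> 0"
proof -
  define M where "M = (\<lambda>t. (LBINT s:{0..t}. quad u g s) - slope t * (u t)\<^sup>2 / c)"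
  have qi: "set_integrable lborel {0..l} (quad u g)" by (rule quad_set_integrable[OF u])
  have "has_L1_deriv 0 l (\<lambda>t. LBINT s:{0..t}. quad u g s) (quad u g)"
    using qi by (rule has_L1_deriv_integral)
  then have cM: "continuous_on {0..l} M"
    unfolding M_def
    by (intro continuous_intros continuous_on_slope_mult_square[OF u z])
      (use c has_L1_deriv_continuous_on in auto)
  have mono: "M s \<le> M t" if st: "0 \<le> s" "s \<le> t" "t \<le> l"
      "\<And>r. s \<le> r \<Longrightarrow> r \<le> t \<Longrightarrow> r \<noteq> l / 4 \<and> r \<noteq> 3 * l / 4" for s t
  proof -
    have "(slope t * (u t)\<^sup>2 - slope s * (u s)\<^sup>2) / c \<le> (LBINT r:{s..t}. quad u g r)"
      by (rule quad_ge_boundary_terms[OF u st(1-3)]) (use st sin_half_nonzero in auto)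
    moreover have "(LBINT r:{0..t}. quad u g r) = (LBINT r:{0..s}. quad u g r) + (LBINT r:{s..t}. quad u g r)"
      by (rule set_integral_Icc_combine[OF set_integrable_subset[OF qi] st(1,2)]) (use st in auto)
    ultimately show ?thesis unfolding M_def by (simp add: diff_divide_distrib)
  qed
  have "M 0 \<le> M (l / 4)"
    by (rule continuous_on_mono_open_imp_le) (use l mono in \<open>auto intro: continuous_on_subset[OF cM]\<close>)
  also have "\<dots> \<le> M (3 * l / 4)"
    by (rule continuous_on_mono_open_imp_le) (use l mono in \<open>auto intro: continuous_on_subset[OF cM]\<close>)
  also have "\<dots> \<le> M l"
    by (rule continuous_on_mono_open_imp_le) (use l mono in \<open>auto intro: continuous_on_subset[OF cM]\<close>)
  finally have "M 0 \<le> M l" .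
  then show ?thesis unfolding M_def set_integral_Icc_refl by (simp add: slope_def P_ends)
qed

lemma quad_nonneg:
  assumes v: "has_weak_deriv 0 l v g" and per: "v 0 = v l" and z: "v (l / 4) + v (3 * l / 4) = 0"
  shows "(LBINT s:{0..l}. quad v g s) \<ge> 0"
proof -
  have P: "P (l / 4) \<noteq> 0" using P_square[of "l / 4"] X_zeros k by auto
  \<comment> \<open>\<open>P\<close> takes opposite values at the two zeros of \<open>X\<close>, and
    so does \<open>v\<close>, so one multiple of \<open>P\<close> cancels \<open>v\<close> at
    both.\<close>
  define \<kappa> where "\<kappa> = v (l / 4) / P (l / 4)"
  define u where "u = (\<lambda>s. v s + (- \<kappa>) * P s)"
  define h where "h = (\<lambda>s. g s + (- \<kappa>) * (- c * sin (X s)))"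
  have u: "has_weak_deriv 0 l u h"
    unfolding u_def h_def by (rule has_weak_deriv_add_scaled[OF v weak_deriv_P])
  have uz: "u (l / 4) = 0" "u (3 * l / 4) = 0"
    using P z unfolding u_def \<kappa>_def X_zeros by auto
  \<comment> \<open>Expanding \<open>quad\<close> at \<open>v = u + \<kappa> * P\<close>, the mixed
    part is \<open>- 2 * \<kappa> * G\<close> and the pure \<open>P\<close> part is
    \<open>- \<kappa>\<^sup>2 * H\<close>. Both are exact derivatives, of multiples of
    \<open>u * sin X\<close> and \<open>P * sin X\<close>, with equal end values.\<close>
  define G where "G = (\<lambda>s. h s * sin (X s) + u s * (cos (X s) * (c * P s)))"
  define H where "H = (\<lambda>s. - c * sin (X s) * sin (X s) + P s * (cos (X s) * (c * P s)))"
  have "has_weak_deriv 0 l (\<lambda>s. sin (X s)) (\<lambda>s. cos (X s) * (c * P s))"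
    by (rule has_weak_deriv_C1)
      (auto intro!: derivative_eq_intros dX continuous_intros continuous_X continuous_P)
  note sinX = has_weak_deriv_imp_has_L1_deriv[OF this]
  have G: "has_L1_deriv 0 l (\<lambda>s. u s * sin (X s)) G"
    unfolding G_def by (rule has_L1_deriv_mult[OF has_weak_deriv_imp_has_L1_deriv[OF u] sinX])
  have H: "has_L1_deriv 0 l (\<lambda>s. P s * sin (X s)) H"
    unfolding H_def by (rule has_L1_deriv_mult[OF has_weak_deriv_imp_has_L1_deriv[OF weak_deriv_P] sinX])
  have G0: "(LBINT s:{0..l}. G s) = 0"
    using has_L1_deriv_diff[OF G, of 0 l] l per unfolding u_def by (simp add: P_ends X_l)
  have H0: "(LBINT s:{0..l}. H s) = 0"
    using has_L1_deriv_diff[OF H, of 0 l] l by (simp add: P_ends)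
  have i1: "set_integrable lborel {0..l} (\<lambda>s. (- 2 * \<kappa>) * G s)"
    using has_L1_derivD(1)[OF G] by (rule set_integrable_mult_right)
  have i2: "set_integrable lborel {0..l} (\<lambda>s. (- \<kappa>\<^sup>2) * H s)"
    using has_L1_derivD(1)[OF H] by (rule set_integrable_mult_right)
  have i3: "set_integrable lborel {0..l} (quad u h)" by (rule quad_set_integrable[OF u])
  have "quad v g s = (quad u h s + (- 2 * \<kappa>) * G s) + (- \<kappa>\<^sup>2) * H s" for s
    unfolding quad_def G_def H_def u_def h_def using c
    by (simp add: field_simps power2_eq_square)
  then have "(LBINT s:{0..l}. quad v g s) = (LBINT s:{0..l}. (quad u h s + (- 2 * \<kappa>) * G s) + (- \<kappa>\<^sup>2) * H s)"
    by presburger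
  also have "\<dots> = (LBINT s:{0..l}. quad u h s + (- 2 * \<kappa>) * G s) + (LBINT s:{0..l}. (- \<kappa>\<^sup>2) * H s)"
    by (rule set_integral_add(2)[OF set_integral_add(1)[OF i3 i1] i2])
  also have "(LBINT s:{0..l}. quad u h s + (- 2 * \<kappa>) * G s) =
      (LBINT s:{0..l}. quad u h s) + (LBINT s:{0..l}. (- 2 * \<kappa>) * G s)"
    by (rule set_integral_add(2)[OF i3 i1])
  finally have "(LBINT s:{0..l}. quad v g s) = (LBINT s:{0..l}. quad u h s)"
    by (simp only: set_integral_mult_right G0 H0)
  then show ?thesis using quad_nonneg_vanishing[OF u uz] by simp
qed

end

section \<open>A two-dimensional negative subspace\<close>

lemma real_interior_Icc: "x \<in> {a<..<b} \<Longrightarrow> at x within {a..b} = at (x::real)"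
  by (rule at_within_interior) simp

text \<open>The integrand of the second variation minus an exact derivative: \<open>d\<close> and \<open>z\<close> stand for
  \<open>cos (X / 2)\<close> and the variation solving \<open>- z'' - c\<^sup>2 cos X z = 2 c\<^sup>2 sin X\<close>.\<close>

lemma second_variation_identity:
  fixes a b c d g m p s th v v1 w z d2 z2 :: real
  assumes c: "c \<noteq> 0"
    and z: "z = th * p + 4 * b * s" and v: "v = a * d + g * z"
    and d2: "d2 = - (c * c) * d * (m - 1 + w)" and z2: "z2 = - 2 * (c * c) * s - c * c * w * z"
  shows "(v1 - g * (c * p))\<^sup>2 / c - 2 * (g * c) * v * s - c * w * v\<^sup>2 =
    (v1 * v1 + v * (a * d2 + g * z2)) / c - 2 * g * (v1 * p - v * (c * s)) + a * g * ((d * z2 - z * d2) / c)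
    + g\<^sup>2 * ((c - b * (c * p\<^sup>2)) * p\<^sup>2 - 2 * th * (c * s) * p) + 4 * g\<^sup>2 * b * (c * p\<^sup>2 * w - c * s\<^sup>2)
    + (a\<^sup>2 * c * (m - 1) * d\<^sup>2 + g\<^sup>2 * c * b * (p\<^sup>2 * p\<^sup>2 - 4 * s\<^sup>2 - 4 * p\<^sup>2 * w))"
proof -
  \<comment> \<open>Removing the divisions by \<open>c\<close> from the quotients first leaves a
    polynomial identity.\<close>
  have e1: "(v1 - g * (c * p))\<^sup>2 / c = v1 * v1 / c - 2 * g * v1 * p + g\<^sup>2 * c * p\<^sup>2"
    using c by (simp add: field_simps power2_eq_square)
  have e2: "(v1 * v1 + v * (a * d2 + g * z2)) / c =
      v1 * v1 / c - v * (a * c * d * (m - 1 + w) + g * (2 * c * s + c * w * z))"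
    unfolding d2 z2 using c by (simp add: field_simps)
  have e3: "(d * z2 - z * d2) / c = - 2 * c * s * d - c * w * z * d + c * z * d * (m - 1 + w)"
    unfolding d2 z2 using c by (simp add: field_simps)
  show ?thesis
    unfolding e1 e2 e3 unfolding v z by (simp add: algebra_simps power2_eq_square)
qed

context scaled_libration
begin

lemma antiderivative_P_square:
  obtains J where "\<And>s. 0 \<le> s \<Longrightarrow> s \<le> l \<Longrightarrow> (J has_real_derivative c * (P s)\<^sup>2) (at s)"
    and "J 0 = 0" and "J l > 0"
proof -
  \<comment> \<open>Starting the integral at -1 makes 0 an interior point, so \<open>J\<close> has a
    two-sided derivative at the ends of \<open>[0, l]\<close>.\<close>
  define J where "J = (\<lambda>t. integral {-1..t} (\<lambda>s. c * (P s)\<^sup>2) - integral {-1..0} (\<lambda>s. c * (P s)\<^sup>2))"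
  have dJ: "(J has_real_derivative c * (P s)\<^sup>2) (at s)" if "0 \<le> s" "s \<le> l" for s
  proof -
    have "((\<lambda>t. integral {-1..t} (\<lambda>s. c * (P s)\<^sup>2)) has_real_derivative c * (P s)\<^sup>2) (at s within {-1..l + 1})"
      by (rule integral_has_real_derivative) (use that in \<open>auto intro!: continuous_intros continuous_P\<close>)
    then have "((\<lambda>t. integral {-1..t} (\<lambda>s. c * (P s)\<^sup>2)) has_real_derivative c * (P s)\<^sup>2) (at s)"
      using real_interior_Icc[of s "-1" "l + 1"] that by simp
    then show ?thesis unfolding J_def by (rule DERIV_cong[OF DERIV_diff[OF _ DERIV_const]]) simp
  qed
  have mono: "J a \<le> J b" if "0 \<le> a" "a \<le> b" "b \<le> l" for a b
  proof (rule DERIV_nonneg_imp_nondecreasing[OF that(2)])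
    fix x assume "a \<le> x" "x \<le> b"
    then show "\<exists>y. (J has_real_derivative y) (at x) \<and> 0 \<le> y"
      using dJ[of x] that c by (intro exI[of _ "c * (P x)\<^sup>2"]) auto
  qed
  \<comment> \<open>\<open>J\<close> is nondecreasing and strictly increasing to the right of
    \<open>l / 4\<close>, because \<open>P\<close> does not vanish at a zero of \<open>X\<close>;
    hence \<open>J l > 0\<close>.\<close>
  have "P (l / 4) \<noteq> 0" using P_square[of "l / 4"] X_zeros k by auto
  then have "c * (P (l / 4))\<^sup>2 > 0" using c by simp
  then obtain e where e: "e > 0" "\<And>h. h > 0 \<Longrightarrow> h < e \<Longrightarrow> J (l / 4) < J (l / 4 + h)"
    using DERIV_pos_inc_right[OF dJ[of "l / 4"]] l by auto
  define h where "h = min e l / 2"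
  have h: "0 < h" "h < e" "h \<le> l / 2" using e l unfolding h_def by auto
  have J0: "J 0 = 0" unfolding J_def by simp
  have "0 \<le> J (l / 4)" using mono[of 0 "l / 4"] l J0 by simp
  also have "\<dots> < J (l / 4 + h)" using e(2) h by simp
  also have "\<dots> \<le> J l" by (rule mono) (use h l in auto)
  finally show thesis using that[OF dJ J0] by simp
qed

text \<open>The integrand with variable period. The factor \<open>\<tau> / c * (c * P s)\<close> is
  left unreduced to match \<open>free_time_action_second_variation\<close> with
  \<open>\<Theta> = c\<close> and \<open>x' = c * P\<close>.\<close>

definition second_var :: "real \<Rightarrow> (real \<Rightarrow> real) \<Rightarrow> (real \<Rightarrow> real) \<Rightarrow> real \<Rightarrow> real"
  where "second_var \<tau> v g s =
    (g s - \<tau> / c * (c * P s))\<^sup>2 / c - 2 * \<tau> * v s * sin (X s) - c * cos (X s) * (v s)\<^sup>2"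

lemma second_var_0: "second_var 0 v g = quad v g"
  unfolding second_var_def quad_def by (rule ext) simp

abbreviation dn :: "real \<Rightarrow> real" where "dn s \<equiv> cos (X s / 2)"
abbreviation dn' :: "real \<Rightarrow> real" where "dn' s \<equiv> - c * P s * sin (X s / 2) / 2"

lemma dn_deriv: "(dn has_real_derivative dn' s) (at s)"
  by (auto intro!: derivative_eq_intros dX)

text \<open>Hence \<open>dn\<close> is an eigenfunction with the negative eigenvalue
  \<open>c\<^sup>2 * (k / 2 - 1)\<close>. The double angle formula extracts the factor
  \<open>dn\<close>, and the energy relation eliminates \<open>P\<close>.\<close>

lemma dn'_deriv: "(dn' has_real_derivative - (c * c) * dn s * (k / 2 - 1 + cos (X s))) (at s)"
proof -
  have "(dn' has_real_derivative - c * (P s * (cos (X s / 2) * (c * P s / 2)) + - c * sin (X s) * sin (X s / 2)) / 2) (at s)"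
    by (auto intro!: derivative_eq_intros dX dP simp: field_simps)
  moreover have "- c * (P s * (dn s * (c * P s / 2)) + - c * sin (X s) * sin (X s / 2)) / 2 =
      - (c * c) * dn s * ((P s)\<^sup>2 / 4 - (sin (X s / 2))\<^sup>2)"
  proof -
    have "- c * (p * (d * (c * p / 2)) + - c * (2 * r * d) * r) / 2 = - (c * c) * d * (p\<^sup>2 / 4 - r\<^sup>2)"
      for p d r :: real
      by (simp add: field_simps power2_eq_square)
    then show ?thesis unfolding sin_X .
  qed
  moreover have "(P s)\<^sup>2 / 4 - (sin (X s / 2))\<^sup>2 = k / 2 - 1 + cos (X s)"
    unfolding P_square cos_X by (simp add: field_simps)
  ultimately show ?thesis by (simp only:)
qed

lemma weak_deriv_dn: "has_weak_deriv a b dn dn'"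
  by (rule has_weak_deriv_C1[OF dn_deriv]) (intro continuous_intros continuous_P continuous_X; simp)

text \<open>The plane is spanned by \<open>(dn, 0)\<close> and \<open>(Z, c)\<close>. Pointwise,
  \<open>second_var\<close> is at most an exact derivative minus a positive constant
  \<open>N\<close>, and the exact derivative integrates to 0.\<close>

lemma negative_plane:
  obtains Z Z' where "has_weak_deriv 0 l Z Z'" and "Z 0 = Z l"
    and "\<forall>\<alpha> \<gamma>. \<alpha> \<noteq> 0 \<or> \<gamma> \<noteq> 0 \<longrightarrow>
      (LBINT s:{0..l}. second_var (\<gamma> * c) (\<lambda>s. \<alpha> * dn s + \<gamma> * Z s) (\<lambda>s. \<alpha> * dn' s + \<gamma> * Z' s) s) < 0"
proof -
  obtain J where dJ: "\<And>s. 0 \<le> s \<Longrightarrow> s \<le> l \<Longrightarrow> (J has_real_derivative c * (P s)\<^sup>2) (at s)"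
    and J: "J 0 = 0" "J l > 0"
    using antiderivative_P_square by blast
  \<comment> \<open>This value makes \<open>\<theta>\<close> vanish at \<open>l\<close> as well as
    at 0.\<close>
  define \<beta> where "\<beta> = c * l / J l"
  have \<beta>: "\<beta> > 0" using c l J unfolding \<beta>_def by simp
  define \<theta> where "\<theta> = (\<lambda>s. c * s - \<beta> * J s)"
  have \<theta>_ends: "\<theta> 0 = 0" "\<theta> l = 0" using J unfolding \<theta>_def \<beta>_def by auto
  have d\<theta>: "(\<theta> has_real_derivative c - \<beta> * (c * (P s)\<^sup>2)) (at s)" if "0 \<le> s" "s \<le> l" for s
    unfolding \<theta>_def by (auto intro!: derivative_eq_intros dJ that)
  define Z where "Z = (\<lambda>s. \<theta> s * P s + 4 * \<beta> * sin (X s))"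
  define Z' where "Z' = (\<lambda>s. (c - \<beta> * (c * (P s)\<^sup>2)) * P s - \<theta> s * (c * sin (X s)) + 4 * \<beta> * (cos (X s) * (c * P s)))"
  have dZ: "(Z has_real_derivative Z' s) (at s)" if "0 \<le> s" "s \<le> l" for s
    unfolding Z_def Z'_def by (auto intro!: derivative_eq_intros d\<theta> dP dX that)
  have dZ': "(Z' has_real_derivative - 2 * (c * c) * sin (X s) - c * c * cos (X s) * Z s) (at s)"
    if "0 \<le> s" "s \<le> l" for s
  proof -
    have "(Z' has_real_derivative
       (- \<beta> * (c * (2 * P s * (- c * sin (X s))))) * P s + (c - \<beta> * (c * (P s)\<^sup>2)) * (- c * sin (X s))
       - ((c - \<beta> * (c * (P s)\<^sup>2)) * (c * sin (X s)) + \<theta> s * (c * (cos (X s) * (c * P s))))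
       + 4 * \<beta> * (- sin (X s) * (c * P s) * (c * P s) + cos (X s) * (c * (- c * sin (X s))))) (at s)"
      unfolding Z'_def
      by (auto intro!: derivative_eq_intros d\<theta> dP dX that)
    moreover have "(- \<beta> * (c * (2 * P s * (- c * sin (X s))))) * P s + (c - \<beta> * (c * (P s)\<^sup>2)) * (- c * sin (X s))
       - ((c - \<beta> * (c * (P s)\<^sup>2)) * (c * sin (X s)) + \<theta> s * (c * (cos (X s) * (c * P s))))
       + 4 * \<beta> * (- sin (X s) * (c * P s) * (c * P s) + cos (X s) * (c * (- c * sin (X s))))
       = - 2 * (c * c) * sin (X s) - c * c * cos (X s) * Z s"
      unfolding Z_def by (simp add: algebra_simps power2_eq_square)
    ultimately show ?thesis by simp
  qed
  have c\<theta>: "continuous_on {0..l} \<theta>"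
    by (rule DERIV_continuous_on, rule has_field_derivative_at_within, rule d\<theta>) auto
  have cZ: "continuous_on {0..l} Z" and cZ': "continuous_on {0..l} Z'"
    unfolding Z_def Z'_def by (intro continuous_intros continuous_P continuous_X c\<theta>)+
  have wZ: "has_weak_deriv 0 l Z Z'"
    by (rule has_weak_deriv_C1[OF dZ cZ']) auto
  have neg: "(LBINT s:{0..l}. second_var (\<gamma> * c) (\<lambda>s. \<alpha> * dn s + \<gamma> * Z s) (\<lambda>s. \<alpha> * dn' s + \<gamma> * Z' s) s) < 0"
    if nz: "\<alpha> \<noteq> 0 \<or> \<gamma> \<noteq> 0" for \<alpha> \<gamma>
  proof -
    define v where "v = (\<lambda>s. \<alpha> * dn s + \<gamma> * Z s)"
    define v1 where "v1 = (\<lambda>s. \<alpha> * dn' s + \<gamma> * Z' s)"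
    define v2 where "v2 = (\<lambda>s. \<alpha> * (- (c * c) * dn s * (k / 2 - 1 + cos (X s)))
      + \<gamma> * (- 2 * (c * c) * sin (X s) - c * c * cos (X s) * Z s))"
    have dv: "(v has_real_derivative v1 s) (at s)" if "0 \<le> s" "s \<le> l" for s
      unfolding v_def v1_def by (intro DERIV_add DERIV_cmult dn_deriv dZ that)
    have dv1: "(v1 has_real_derivative v2 s) (at s)" if "0 \<le> s" "s \<le> l" for s
      unfolding v1_def v2_def by (intro DERIV_add DERIV_cmult dn'_deriv dZ' that)
    \<comment> \<open>The first two terms integrate \<open>v1\<^sup>2\<close> and
      \<open>v1 * P\<close> by parts. The third is a Wronskian of \<open>dn\<close> and
      \<open>Z\<close>: it absorbs all terms in \<open>\<alpha> * \<gamma>\<close>, which expresses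
      the orthogonality of the two directions.\<close>
    define \<Phi> where "\<Phi> = (\<lambda>s. v s * v1 s / c - 2 * \<gamma> * (v s * P s) + \<alpha> * \<gamma> * ((dn s * Z' s - Z s * dn' s) / c)
      + \<gamma>\<^sup>2 * (\<theta> s * (P s)\<^sup>2) + 4 * \<gamma>\<^sup>2 * \<beta> * (P s * sin (X s)))"
    define \<phi> where "\<phi> = (\<lambda>s. (v1 s * v1 s + v s * v2 s) / c - 2 * \<gamma> * (v1 s * P s - v s * (c * sin (X s)))
      + \<alpha> * \<gamma> * ((dn s * (- 2 * (c * c) * sin (X s) - c * c * cos (X s) * Z s)
          - Z s * (- (c * c) * dn s * (k / 2 - 1 + cos (X s)))) / c)
      + \<gamma>\<^sup>2 * ((c - \<beta> * (c * (P s)\<^sup>2)) * (P s)\<^sup>2 - 2 * \<theta> s * (c * sin (X s)) * P s)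
      + 4 * \<gamma>\<^sup>2 * \<beta> * (c * (P s)\<^sup>2 * cos (X s) - c * (sin (X s))\<^sup>2))"
    have d\<Phi>: "(\<Phi> has_real_derivative \<phi> s) (at s)" if s: "0 \<le> s" "s \<le> l" for s
    proof -
      have a1: "((\<lambda>s. v s * v1 s / c) has_real_derivative (v1 s * v1 s + v s * v2 s) / c) (at s)"
        using DERIV_cdivide[OF DERIV_mult[OF dv[OF s] dv1[OF s]], of c] by (simp add: algebra_simps)
      have a2: "((\<lambda>s. 2 * \<gamma> * (v s * P s)) has_real_derivative 2 * \<gamma> * (v1 s * P s - v s * (c * sin (X s)))) (at s)"
        using DERIV_cmult[OF DERIV_mult[OF dv[OF s] dP], of "2 * \<gamma>"] by (simp add: algebra_simps)
      have a3: "((\<lambda>s. \<alpha> * \<gamma> * ((dn s * Z' s - Z s * dn' s) / c)) has_real_derivative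
        \<alpha> * \<gamma> * ((dn s * (- 2 * (c * c) * sin (X s) - c * c * cos (X s) * Z s)
          - Z s * (- (c * c) * dn s * (k / 2 - 1 + cos (X s)))) / c)) (at s)"
        using DERIV_cmult[OF DERIV_cdivide[OF DERIV_diff[OF DERIV_mult[OF dn_deriv dZ'[OF s]]
              DERIV_mult[OF dZ[OF s] dn'_deriv]], of c], of "\<alpha> * \<gamma>"]
        by (rule DERIV_cong) (simp add: mult.commute)
      have a4: "((\<lambda>s. \<gamma>\<^sup>2 * (\<theta> s * (P s)\<^sup>2)) has_real_derivative
        \<gamma>\<^sup>2 * ((c - \<beta> * (c * (P s)\<^sup>2)) * (P s)\<^sup>2 - 2 * \<theta> s * (c * sin (X s)) * P s)) (at s)"
        by (rule DERIV_cong[OF DERIV_cmult[OF DERIV_mult[OF d\<theta>[OF s] DERIV_power[OF dP, of 2]]]])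
          (simp add: algebra_simps power2_eq_square)
      have a5: "((\<lambda>s. 4 * \<gamma>\<^sup>2 * \<beta> * (P s * sin (X s))) has_real_derivative
        4 * \<gamma>\<^sup>2 * \<beta> * (c * (P s)\<^sup>2 * cos (X s) - c * (sin (X s))\<^sup>2)) (at s)"
        by (rule DERIV_cong[OF DERIV_cmult[OF DERIV_mult[OF dP DERIV_fun_sin[OF dX]]]])
          (simp add: algebra_simps power2_eq_square)
      show ?thesis unfolding \<Phi>_def \<phi>_def
        by (rule DERIV_add[OF DERIV_add[OF DERIV_add[OF DERIV_diff[OF a1 a2] a3] a4] a5])
    qed
    \<comment> \<open>The part with \<open>\<alpha>\<^sup>2\<close> comes from the eigenvalue of
      \<open>dn\<close> and the bound \<open>dn\<^sup>2 \<ge> 1 - k / 2\<close>; the part with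
      \<open>\<gamma>\<^sup>2\<close> is the constant obtained in \<open>e2\<close> from the energy
      relation.\<close>
    define N where "N = c * (1 - k / 2) * (\<alpha>\<^sup>2 * (1 - k / 2) + 8 * \<gamma>\<^sup>2 * \<beta> * k)"
    have "\<alpha>\<^sup>2 * (1 - k / 2) + 8 * \<gamma>\<^sup>2 * \<beta> * k > 0"
      using nz k \<beta> by (cases "\<alpha> = 0") (auto intro!: add_pos_nonneg)
    then have N: "N > 0" unfolding N_def using c k by simp
    have le: "second_var (\<gamma> * c) v v1 s \<le> \<phi> s - N" for s
    proof -
      have e1: "second_var (\<gamma> * c) v v1 s = \<phi> s + (\<alpha>\<^sup>2 * c * (k / 2 - 1) * (dn s)\<^sup>2
          + \<gamma>\<^sup>2 * c * \<beta> * ((P s)\<^sup>2 * (P s)\<^sup>2 - 4 * (sin (X s))\<^sup>2 - 4 * (P s)\<^sup>2 * cos (X s)))"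
      proof -
        have z: "Z s = \<theta> s * P s + 4 * \<beta> * sin (X s)" and v: "v s = \<alpha> * dn s + \<gamma> * Z s"
          unfolding Z_def v_def by simp_all
        have gc: "\<gamma> * c / c = \<gamma>" and c0: "c \<noteq> 0" using c by simp_all
        show ?thesis
          unfolding second_var_def \<phi>_def v2_def gc
          by (rule second_variation_identity[OF c0 z v refl refl])
      qed
      have e2: "(P s)\<^sup>2 * (P s)\<^sup>2 - 4 * (sin (X s))\<^sup>2 - 4 * (P s)\<^sup>2 * cos (X s) = - 8 * k * (1 - k / 2)"
      proof -
        have p: "(P s)\<^sup>2 = 2 * k - 2 + 2 * cos (X s)" using energy[of s] by simp
        show ?thesis unfolding p sin_squared_eq by (simp add: algebra_simps power2_eq_square)
      qed
      have e3: "\<alpha>\<^sup>2 * c * (k / 2 - 1) * (dn s)\<^sup>2 \<le> \<alpha>\<^sup>2 * c * (k / 2 - 1) * (1 - k / 2)"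
      proof (rule mult_left_mono_neg)
        have "4 * (sin (X s / 2))\<^sup>2 \<le> 2 * k" using P_square[of s] zero_le_power2[of "P s"] by linarith
        then show "1 - k / 2 \<le> (dn s)\<^sup>2" unfolding cos_squared_eq by simp
        show "\<alpha>\<^sup>2 * c * (k / 2 - 1) \<le> 0" using c k by (intro mult_nonneg_nonpos) auto
      qed
      have "\<alpha>\<^sup>2 * c * (k / 2 - 1) * (1 - k / 2) + \<gamma>\<^sup>2 * c * \<beta> * (- 8 * k * (1 - k / 2)) = - N"
        unfolding N_def by (simp add: algebra_simps)
      then show ?thesis using e1 e3 unfolding e2 by linarith
    qed
    have cv: "continuous_on {0..l} v" and cv1: "continuous_on {0..l} v1"
      unfolding v_def v1_def by (intro continuous_intros continuous_P continuous_X cZ cZ'; simp)+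
    have i: "set_integrable lborel {0..l} (second_var (\<gamma> * c) v v1)"
      unfolding second_var_def
      by (intro borel_integrable_atLeastAtMost' continuous_intros continuous_P continuous_X cv cv1) (use c in auto)
    have "(\<phi> has_integral \<Phi> l - \<Phi> 0) {0..l}"
      by (rule fundamental_theorem_of_calculus)
        (use l d\<Phi> in \<open>auto intro: has_field_derivative_at_within
          simp: has_real_derivative_iff_has_vector_derivative[symmetric]\<close>)
    \<comment> \<open>\<open>P\<close> and \<open>\<theta>\<close> vanish at both ends and
      \<open>X l = X 0\<close>, so every summand has equal end values.\<close>
    moreover have "\<Phi> l = \<Phi> 0"
      unfolding \<Phi>_def v_def v1_def Z_def Z'_def using P_ends \<theta>_ends by (simp add: X_l)
    ultimately have "(\<phi> has_integral 0) {0..l}" by simp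
    moreover have "((\<lambda>s. N) has_integral N * l) {0..l}"
      using has_integral_const_real[of N 0 l] l by (simp add: mult.commute)
    ultimately have "((\<lambda>s. \<phi> s - N) has_integral 0 - N * l) {0..l}"
      by (rule has_integral_diff)
    moreover have "(second_var (\<gamma> * c) v v1 has_integral (LBINT s:{0..l}. second_var (\<gamma> * c) v v1 s)) {0..l}"
      using set_borel_integral_eq_integral[OF i] by (simp add: has_integral_integral)
    ultimately have "(LBINT s:{0..l}. second_var (\<gamma> * c) v v1 s) \<le> 0 - N * l"
      using has_integral_le le by blast
    also have "\<dots> < 0" using N l by simp
    finally show ?thesis unfolding v_def v1_def .
  qed
  show thesis
  proof (rule that[OF wZ])
    show "Z 0 = Z l" by (simp add: Z_def P_ends X_l)
  qed (blast intro: neg)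
qed

end

section \<open>Indices\<close>

text \<open>\<open>Z\<close> is controlled only on \<open>[0, l]\<close>, while elements of
  \<open>H1_periodic l\<close> are periodic on the whole line.\<close>

definition periodic_extension :: "real \<Rightarrow> (real \<Rightarrow> real) \<Rightarrow> real \<Rightarrow> real"
  where "periodic_extension l w t = w (t - l * of_int \<lfloor>t / l\<rfloor>)"

lemma periodic_extension_periodic:
  "0 < l \<Longrightarrow> periodic_extension l w (t + l) = periodic_extension l w t"
  unfolding periodic_extension_def by (simp add: add_divide_distrib algebra_simps)

text \<open>At \<open>t = l\<close> the extension takes the value \<open>w 0\<close>, which is where
  \<open>w 0 = w l\<close> enters.\<close>

lemma periodic_extension_eq:
  assumes l: "0 < l" and w: "w 0 = w l" and t: "t \<in> {0..l}"
  shows "periodic_extension l w t = w t"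
proof (cases "t = l")
  case True
  then show ?thesis using l w unfolding periodic_extension_def by simp
next
  case False
  then have "\<lfloor>t / l\<rfloor> = 0" using l t by (simp add: floor_eq_iff)
  then show ?thesis unfolding periodic_extension_def by simp
qed

lemma has_weak_deriv_zero: "has_weak_deriv a b (\<lambda>t. 0) (\<lambda>t. 0)"
  by (rule has_weak_deriv_C1) auto

lemma has_weak_deriv_scaleR:
  assumes "has_weak_deriv a b f g"
  shows "has_weak_deriv a b (r *\<^sub>R f) (\<lambda>t. r * g t)"
  using has_weak_deriv_add_scaled[OF has_weak_deriv_zero assms, of r]
  by (simp add: scaleR_fun_def)

lemma has_weak_deriv_linear_combination:
  assumes "has_weak_deriv a b f f'" "has_weak_deriv a b g g'"
  shows "has_weak_deriv a b (\<lambda>t. r * f t + s * g t) (\<lambda>t. r * f' t + s * g' t)"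
  using has_weak_deriv_add_scaled[OF has_weak_deriv_scaleR[OF assms(1)] assms(2), of r s]
  by (simp add: scaleR_fun_def)

lemma subspace_H1: "subspace (H1 a b)"
proof (rule subspaceI)
  show "0 \<in> H1 a b" unfolding H1_def zero_fun_def using has_weak_deriv_zero by blast
  fix f g assume "f \<in> H1 a b" "g \<in> H1 a b"
  then obtain f' g' where "has_weak_deriv a b f f'" "has_weak_deriv a b g g'" unfolding H1_def by blast
  from has_weak_deriv_add_scaled[OF this, of 1] show "f + g \<in> H1 a b"
    unfolding H1_def by (auto simp: plus_fun_def)
next
  fix r f assume "f \<in> H1 a b"
  then show "r *\<^sub>R f \<in> H1 a b" unfolding H1_def using has_weak_deriv_scaleR by blast
qed

lemma subspace_H1_periodic: "subspace (H1_periodic T)"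
  using subspace_H1[of 0 T] unfolding H1_periodic_def subspace_def
  by (auto simp: plus_fun_def scaleR_fun_def zero_fun_def)

lemma subspace_H1_dirichlet: "subspace (H1_dirichlet T)"
  using subspace_H1[of 0 T] unfolding H1_dirichlet_def subspace_def
  by (auto simp: plus_fun_def scaleR_fun_def zero_fun_def)

lemma H1_norm_eq:
  assumes f: "has_weak_deriv 0 T f g"
  shows "H1_norm T f = sqrt (LBINT t:{0..T}. (f t)\<^sup>2 + (g t)\<^sup>2)"
proof -
  have w: "has_weak_deriv 0 T f (weak_deriv 0 T f)"
    unfolding weak_deriv_def using someI[of "has_weak_deriv 0 T f", OF f] .
  have f2: "set_integrable lborel {0..T} (\<lambda>t. (f t)\<^sup>2)"
    by (intro borel_integrable_atLeastAtMost' continuous_intros has_weak_deriv_continuous_on[OF f])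
  have "(LBINT t:{0..T}. (f t)\<^sup>2 + (weak_deriv 0 T f t)\<^sup>2) = (LBINT t:{0..T}. (f t)\<^sup>2 + (g t)\<^sup>2)"
    by (intro set_integral_cong_AE_set_integrable set_integral_add(1) f2 has_weak_derivD(2)[OF w] has_weak_derivD(2)[OF f])
      (use has_weak_deriv_unique[OF w f] in eventually_elim, simp)
  then show ?thesis unfolding H1_norm_def by simp
qed

lemma H1_norm_scaleR:
  assumes f: "has_weak_deriv 0 T f g"
  shows "H1_norm T (r *\<^sub>R f) = \<bar>r\<bar> * H1_norm T f"
proof -
  have "(\<lambda>t. ((r *\<^sub>R f) t)\<^sup>2 + (r * g t)\<^sup>2) = (\<lambda>t. r\<^sup>2 * ((f t)\<^sup>2 + (g t)\<^sup>2))"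
    by (simp add: scaleR_fun_def power_mult_distrib distrib_left)
  then show ?thesis
    unfolding H1_norm_eq[OF f] H1_norm_eq[OF has_weak_deriv_scaleR[OF f]]
    by (simp only: set_integral_mult_right real_sqrt_mult real_sqrt_abs)
qed

text \<open>With the two zeros of \<open>X\<close> as \<open>a\<close> and \<open>b\<close>, the
  kernel of this functional is the codimension one space of \<open>quad_nonneg\<close>.\<close>

lemma linear_evaluation_sum: "linear (\<lambda>v :: real \<Rightarrow> real. v a + v b)"
  by (rule linearI) (simp_all add: plus_fun_def scaleR_fun_def distrib_left)

context scaled_libration
begin

section \<open>Periodic and free-period indices along the orbit\<close>

lemma second_differential_free_time_action:
  assumes "has_weak_deriv 0 l v g"
  shows "second_differential (free_time_action l h) (X, c) (v, \<tau>) (v, \<tau>) =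
    (LBINT s:{0..l}. second_var \<tau> v g s)"
proof (rule free_time_action_second_variation[OF weak_deriv_X assms c, where k = h and \<tau> = \<tau>])
  fix D
  assume "\<forall>\<^sub>F r in nhds 0. ((\<lambda>r. free_time_action l h ((X, c) + r *\<^sub>R (v, \<tau>))) has_real_derivative D r) (at r)"
    "(D has_real_derivative (LBINT s:{0..l}. (g s - \<tau> / c * (c * P s))\<^sup>2 / c
          - 2 * \<tau> * v s * sin (X s) - c * cos (X s) * (v s)\<^sup>2)) (at 0)"
  then show ?thesis unfolding second_var_def by (rule second_differential_diagonal)
qed

lemma second_differential_action:
  assumes "has_weak_deriv 0 l v g" and c1: "c = 1"
  shows "second_differential (action l) X v v = (LBINT s:{0..l}. quad v g s)"
proof -
  have eq: "action l (X + r *\<^sub>R v) = free_time_action l 0 ((X, c) + r *\<^sub>R (v, 0))" for r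
    unfolding action_eq c1 by simp
  obtain D where
    "\<forall>\<^sub>F r in nhds 0. ((\<lambda>r. free_time_action l 0 ((X, c) + r *\<^sub>R (v, 0))) has_real_derivative D r) (at r)"
    "(D has_real_derivative (LBINT s:{0..l}. second_var 0 v g s)) (at 0)"
    unfolding second_var_def
    by (rule free_time_action_second_variation[OF weak_deriv_X assms(1) c, where k = 0 and \<tau> = 0])
  then show ?thesis
    unfolding eq[symmetric] second_var_0
    by (rule second_differential_diagonal[where F = "action l" and x = X and v = v])
qed

lemma quad_nonneg_periodic:
  assumes "v \<in> H1_periodic l" and "v (l / 4) + v (3 * l / 4) = 0"
  obtains g where "has_weak_deriv 0 l v g" and "(LBINT s:{0..l}. quad v g s) \<ge> 0"
proof -
  obtain g where g: "has_weak_deriv 0 l v g" using assms unfolding H1_periodic_def H1_def by auto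
  have "v (0 + l) = v 0" using assms(1) unfolding H1_periodic_def by blast
  then show thesis using that[OF g quad_nonneg[OF g _ assms(2)]] by simp
qed

lemma dn_H1_periodic: "dn \<in> H1_periodic l"
  unfolding H1_periodic_def H1_def using weak_deriv_dn periodic by auto

lemma X_H1_periodic: "X \<in> H1_periodic l"
  unfolding H1_periodic_def H1_def using weak_deriv_X periodic by auto

text \<open>The case \<open>\<gamma> = 0\<close> of the negative plane.\<close>

lemma second_var_integral_dn_neg:
  assumes "a \<noteq> 0"
  shows "(LBINT s:{0..l}. quad (\<lambda>s. a * dn s) (\<lambda>s. a * dn' s) s) < 0"
proof -
  obtain Z Z' where "has_weak_deriv 0 l Z Z'" "Z 0 = Z l"
    and neg: "\<forall>\<alpha> \<gamma>. \<alpha> \<noteq> 0 \<or> \<gamma> \<noteq> 0 \<longrightarrow>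
      (LBINT s:{0..l}. second_var (\<gamma> * c) (\<lambda>s. \<alpha> * dn s + \<gamma> * Z s) (\<lambda>s. \<alpha> * dn' s + \<gamma> * Z' s) s) < 0"
    by (rule negative_plane)
  from neg[rule_format, of a 0] show ?thesis using assms by (simp add: second_var_0)
qed

text \<open>Upper bound: on the kernel of the evaluation sum paired with the period component,
  \<open>\<tau> = 0\<close> and \<open>quad_nonneg\<close> applies. Lower bound: the negative plane,
  with \<open>Z\<close> continued periodically. The constant \<open>h\<close> contributes only a
  term linear in the period.\<close>

lemma morse_index_free_time_action:
  "morse_index (H1_periodic l \<times> UNIV) (second_differential (free_time_action l h) (X, c)) = 2"
proof (rule antisym)
  let ?B = "second_differential (free_time_action l h) (X, c)"
  have lin: "linear (\<lambda>z :: (real \<Rightarrow> real) \<times> real. (fst z (l / 4) + fst z (3 * l / 4), snd z))"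
    by (rule linearI) (simp_all add: plus_fun_def scaleR_fun_def distrib_left)
  have "morse_index (H1_periodic l \<times> UNIV) ?B \<le> enat DIM(real \<times> real)"
  proof (rule morse_index_le_DIM[OF lin])
    fix z :: "(real \<Rightarrow> real) \<times> real"
    assume z: "z \<in> H1_periodic l \<times> UNIV" "(fst z (l / 4) + fst z (3 * l / 4), snd z) = 0"
    obtain v where zv: "z = (v, 0)" "v \<in> H1_periodic l" "v (l / 4) + v (3 * l / 4) = 0"
      using z by (cases z) (auto simp: zero_prod_def)
    obtain g where "has_weak_deriv 0 l v g" "(LBINT s:{0..l}. quad v g s) \<ge> 0"
      using quad_nonneg_periodic zv by blast
    then show "0 \<le> ?B z z"
      unfolding zv(1) by (simp add: second_differential_free_time_action second_var_0)
  qed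
  then show "morse_index (H1_periodic l \<times> UNIV) ?B \<le> 2"
    by (simp add: numeral_2_eq_2 numeral_eq_enat)
next
  let ?B = "second_differential (free_time_action l h) (X, c)"
  obtain Z Z' where Z: "has_weak_deriv 0 l Z Z'" "Z 0 = Z l"
    and neg: "\<forall>\<alpha> \<gamma>. \<alpha> \<noteq> 0 \<or> \<gamma> \<noteq> 0 \<longrightarrow>
      (LBINT s:{0..l}. second_var (\<gamma> * c) (\<lambda>s. \<alpha> * dn s + \<gamma> * Z s) (\<lambda>s. \<alpha> * dn' s + \<gamma> * Z' s) s) < 0"
    by (rule negative_plane)
  define Y where "Y = periodic_extension l Z"
  have Y: "Y s = Z s" if "s \<in> {0..l}" for s
    unfolding Y_def by (rule periodic_extension_eq[OF l Z(2) that])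
  have wY: "has_weak_deriv 0 l Y Z'"
    by (rule has_weak_deriv_cong[OF Z(1)]) (simp add: Y)
  then have YH: "Y \<in> H1_periodic l"
    unfolding H1_periodic_def H1_def Y_def using periodic_extension_periodic[OF l] by auto
  show "2 \<le> morse_index (H1_periodic l \<times> UNIV) ?B"
  proof (rule morse_index_ge_2[of _ "(dn, 0)" "(Y, c)"])
    show "subspace (H1_periodic l \<times> (UNIV :: real set))"
      by (intro subspace_Times subspace_H1_periodic subspace_UNIV)
    fix a b :: real assume ab: "a \<noteq> 0 \<or> b \<noteq> 0"
    define v where "v = (\<lambda>s. a * dn s + b * Y s)"
    define g where "g = (\<lambda>s. a * dn' s + b * Z' s)"
    have v: "has_weak_deriv 0 l v g"
      unfolding v_def g_def by (rule has_weak_deriv_linear_combination[OF weak_deriv_dn wY])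
    have "a *\<^sub>R (dn, 0) + b *\<^sub>R (Y, c) = (v, b * c)"
      unfolding v_def by (simp add: plus_fun_def scaleR_fun_def)
    then have "?B (a *\<^sub>R (dn, 0) + b *\<^sub>R (Y, c)) (a *\<^sub>R (dn, 0) + b *\<^sub>R (Y, c)) =
        (LBINT s:{0..l}. second_var (b * c) v g s)"
      by (simp only: second_differential_free_time_action[OF v])
    also have "\<dots> = (LBINT s:{0..l}. second_var (b * c) (\<lambda>s. a * dn s + b * Z s) g s)"
      by (rule set_lebesgue_integral_cong) (auto simp: second_var_def v_def Y)
    also have "\<dots> < 0" unfolding g_def by (rule neg[rule_format, OF ab])
    finally show "?B (a *\<^sub>R (dn, 0) + b *\<^sub>R (Y, c)) (a *\<^sub>R (dn, 0) + b *\<^sub>R (Y, c)) < 0" .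
  qed (use dn_H1_periodic YH second_differential_zero in auto)
qed

lemma morse_index_action_periodic:
  assumes c1: "c = 1"
  shows "morse_index (H1_periodic l) (second_differential (action l) X) = 1"
proof (rule antisym)
  have "morse_index (H1_periodic l) (second_differential (action l) X) \<le> enat DIM(real)"
  proof (rule morse_index_le_DIM[OF linear_evaluation_sum[of "l / 4" "3 * l / 4"]])
    fix v :: "real \<Rightarrow> real"
    assume "v \<in> H1_periodic l" "v (l / 4) + v (3 * l / 4) = 0"
    then obtain g where "has_weak_deriv 0 l v g" "(LBINT s:{0..l}. quad v g s) \<ge> 0"
      using quad_nonneg_periodic by blast
    then show "0 \<le> second_differential (action l) X v v"
      by (simp add: second_differential_action[OF _ c1])
  qed
  then show "morse_index (H1_periodic l) (second_differential (action l) X) \<le> 1"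
    by (simp add: one_enat_def)
  show "1 \<le> morse_index (H1_periodic l) (second_differential (action l) X)"
  proof (rule morse_index_ge_1[where v = dn])
    fix a :: real assume a: "a \<noteq> 0"
    have w: "has_weak_deriv 0 l (a *\<^sub>R dn) (\<lambda>s. a * dn' s)"
      by (rule has_weak_deriv_scaleR[OF weak_deriv_dn])
    have eq: "a *\<^sub>R dn = (\<lambda>s. a * dn s)" by (simp add: scaleR_fun_def)
    show "second_differential (action l) X (a *\<^sub>R dn) (a *\<^sub>R dn) < 0"
      unfolding second_differential_action[OF w c1] unfolding eq by (rule second_var_integral_dn_neg[OF a])
  qed (rule subspace_H1_periodic dn_H1_periodic second_differential_zero)+
qed

section \<open>Failure of minimality\<close>

text \<open>The direction \<open>dn\<close> keeps the period fixed, so it serves both variational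
  problems. The first variation along it is the integral of the derivative of \<open>P * dn\<close>,
  which is 0 since \<open>P\<close> vanishes at both ends.\<close>

lemma free_time_action_decreasing_direction:
  obtains D E where
    "\<forall>\<^sub>F r in nhds 0. ((\<lambda>r. free_time_action l h ((X, c) + r *\<^sub>R (dn, 0))) has_real_derivative D r) (at r)"
    "(D has_real_derivative E) (at 0)" "D 0 = 0" "E < 0"
proof -
  obtain D where D:
    "\<forall>\<^sub>F r in nhds 0. ((\<lambda>r. free_time_action l h ((X, c) + r *\<^sub>R (dn, 0))) has_real_derivative D r) (at r)"
    "(D has_real_derivative (LBINT s:{0..l}. second_var 0 dn dn' s)) (at 0)"
    and D0: "D 0 = (LBINT s:{0..l}. c * P s * dn' s) / c - c * (LBINT s:{0..l}. dn s * sin (X s))"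
    unfolding second_var_def
    by (rule free_time_action_second_variation[OF weak_deriv_X weak_deriv_dn c, where k = h and \<tau> = 0]) simp
  have neg: "(LBINT s:{0..l}. second_var 0 dn dn' s) < 0"
    using second_var_integral_dn_neg[of 1] by (simp add: second_var_0)
  define G where "G = (\<lambda>s. - c * sin (X s) * dn s + P s * dn' s)"
  have G: "has_L1_deriv 0 l (\<lambda>s. P s * dn s) G"
    unfolding G_def by (intro has_L1_deriv_mult has_weak_deriv_imp_has_L1_deriv weak_deriv_P weak_deriv_dn)
  have "(LBINT s:{0..l}. G s) = 0"
    using has_L1_deriv_diff[OF G, of 0 l] l by (simp add: P_ends)
  moreover have "(LBINT s:{0..l}. G s) = (LBINT s:{0..l}. c * P s * dn' s) / c - c * (LBINT s:{0..l}. dn s * sin (X s))"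
  proof -
    have i1: "set_integrable lborel {0..l} (\<lambda>s. c * P s * dn' s / c)"
      by (intro borel_integrable_atLeastAtMost' continuous_intros continuous_P continuous_X) (use c in auto)
    have i2: "set_integrable lborel {0..l} (\<lambda>s. c * (dn s * sin (X s)))"
      by (intro borel_integrable_atLeastAtMost' continuous_intros continuous_P continuous_X) auto
    have "G = (\<lambda>s. c * P s * dn' s / c - c * (dn s * sin (X s)))"
      unfolding G_def by (rule ext) (use c in \<open>simp add: field_simps\<close>)
    then have "(LBINT s:{0..l}. G s) = (LBINT s:{0..l}. c * P s * dn' s / c - c * (dn s * sin (X s)))"
      by (simp only:)
    also have "\<dots> = (LBINT s:{0..l}. c * P s * dn' s / c) - (LBINT s:{0..l}. c * (dn s * sin (X s)))"
      by (rule set_integral_diff(2)[OF i1 i2])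
    finally show ?thesis by (simp only: set_integral_mult_right set_integral_divide_zero)
  qed
  ultimately have "D 0 = 0" using D0 by simp
  then show thesis using that D neg by blast
qed

lemma not_local_minimizer_free_time_action:
  "\<not> local_minimizer (\<lambda>(\<xi>, \<tau>). sqrt ((H1_norm l \<xi>)\<^sup>2 + \<tau>\<^sup>2)) (H1_periodic l \<times> {0<..})
    (free_time_action l h) (X, c)"
proof -
  obtain D E where D:
    "\<forall>\<^sub>F r in nhds 0. ((\<lambda>r. free_time_action l h ((X, c) + r *\<^sub>R (dn, 0))) has_real_derivative D r) (at r)"
    "(D has_real_derivative E) (at 0)" "D 0 = 0" "E < 0"
    using free_time_action_decreasing_direction by blast
  show ?thesis
  proof (rule not_local_minimizer_second_order[OF D])
    fix r :: real
    have "X + r *\<^sub>R dn \<in> H1_periodic l"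
      using subspace_H1_periodic X_H1_periodic dn_H1_periodic by (simp add: subspace_add subspace_scale)
    then show "(X, c) + r *\<^sub>R (dn, 0) \<in> H1_periodic l \<times> {0<..}" using c by simp
    \<comment> \<open>The absolute value around \<open>H1_norm l dn\<close> comes from the square
      root of a square.\<close>
    show "(case r *\<^sub>R (dn, 0) of (\<xi>, \<tau>) \<Rightarrow> sqrt ((H1_norm l \<xi>)\<^sup>2 + \<tau>\<^sup>2)) = \<bar>r\<bar> * \<bar>H1_norm l dn\<bar>"
      using H1_norm_scaleR[OF weak_deriv_dn, of l r] by (simp add: abs_mult)
  qed
qed

lemma not_local_minimizer_action:
  assumes c1: "c = 1"
  shows "\<not> local_minimizer (H1_norm l) (H1_periodic l) (action l) X"
proof -
  have eq: "action l (X + r *\<^sub>R dn) = free_time_action l 0 ((X, c) + r *\<^sub>R (dn, 0))" for r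
    unfolding action_eq c1 by simp
  obtain D E where D:
    "\<forall>\<^sub>F r in nhds 0. ((\<lambda>r. free_time_action l 0 ((X, c) + r *\<^sub>R (dn, 0))) has_real_derivative D r) (at r)"
    "(D has_real_derivative E) (at 0)" "D 0 = 0" "E < 0"
    using free_time_action_decreasing_direction by blast
  show ?thesis
  proof (rule not_local_minimizer_second_order[where F = "action l" and x = X and v = dn, OF D(1)[folded eq] D(2-)])
    fix r :: real
    show "X + r *\<^sub>R dn \<in> H1_periodic l"
      using subspace_H1_periodic X_H1_periodic dn_H1_periodic by (simp add: subspace_add subspace_scale)
    show "H1_norm l (r *\<^sub>R dn) = \<bar>r\<bar> * H1_norm l dn" by (rule H1_norm_scaleR[OF weak_deriv_dn])
  qed
qed


section \<open>The Dirichlet index\<close>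

text \<open>\<open>\<bar>P\<bar>\<close> has vanishing second variation and a corner at \<open>l / 2\<close>; adding a small multiple of a
  function that is positive at the corner makes the second variation negative.\<close>

lemma dirichlet_direction:
  obtains w h where "has_weak_deriv 0 l w h" and "w \<in> H1_dirichlet l"
    and "(LBINT s:{0..l}. quad w h s) < 0"
proof -
  \<comment> \<open>Vanishes at 0 and \<open>l\<close>, and equals \<open>2 * X 0 > 0\<close> at the
    corner \<open>l / 2\<close>.\<close>
  define \<eta> where "\<eta> = (\<lambda>s. X 0 - X s)"
  define \<eta>' where "\<eta>' = (\<lambda>s. - c * P s)"
  have d\<eta>: "(\<eta> has_real_derivative \<eta>' s) (at s)" for s
    unfolding \<eta>_def \<eta>'_def by (auto intro!: derivative_eq_intros dX)
  have w\<eta>: "has_weak_deriv 0 l \<eta> \<eta>'"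
    by (rule has_weak_deriv_C1[OF d\<eta>]) (unfold \<eta>'_def, intro continuous_intros continuous_P)
  define R where "R = (LBINT s:{0..l}. quad \<eta> \<eta>' s)"
  have sin0: "sin (X 0) > 0" using X_0 by (simp add: sin_gt_zero)
  \<comment> \<open>The second variation will be
    \<open>\<epsilon> * (\<epsilon> * R - 8 * (X 0 * sin (X 0)))\<close>; this choice makes the
    bracket negative whatever the sign of \<open>R\<close>.\<close>
  define \<epsilon> where "\<epsilon> = X 0 * sin (X 0) / (\<bar>R\<bar> + 1)"
  have \<epsilon>: "\<epsilon> > 0" unfolding \<epsilon>_def using sin0 X_0 by (intro divide_pos_pos mult_pos_pos) auto
  have \<epsilon>R: "\<epsilon> * R < 8 * (X 0 * sin (X 0))"
  proof -
    have "\<epsilon> * R \<le> \<epsilon> * (\<bar>R\<bar> + 1)" using \<epsilon> by (intro mult_left_mono) auto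
    also have "\<dots> = X 0 * sin (X 0)" unfolding \<epsilon>_def by simp
    also have "\<dots> < 8 * (X 0 * sin (X 0))" using sin0 X_0 by simp
    finally show ?thesis .
  qed
  define w where "w = (\<lambda>s. if s \<le> l / 2 then - P s + \<epsilon> * \<eta> s else P s + \<epsilon> * \<eta> s)"
  define h where "h = (\<lambda>s. if s \<le> l / 2 then c * sin (X s) + \<epsilon> * \<eta>' s else - c * sin (X s) + \<epsilon> * \<eta>' s)"
  have cont\<eta>: "continuous_on A \<eta>" "continuous_on A \<eta>'" for A
    unfolding \<eta>_def \<eta>'_def by (intro continuous_intros continuous_X continuous_P)+
  have dw1: "((\<lambda>s. - P s + \<epsilon> * \<eta> s) has_real_derivative c * sin (X s) + \<epsilon> * \<eta>' s) (at s)" for s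
    by (auto intro!: derivative_eq_intros dP d\<eta>)
  have dw2: "((\<lambda>s. P s + \<epsilon> * \<eta> s) has_real_derivative - c * sin (X s) + \<epsilon> * \<eta>' s) (at s)" for s
    by (auto intro!: derivative_eq_intros dP d\<eta>)
  have wh: "has_weak_deriv 0 l w h"
  proof (rule has_weak_deriv_piecewise[of "{l / 2}"])
    show "continuous_on {0..l} w"
      unfolding w_def
    proof (rule continuous_on_cases_le[where h = "\<lambda>s. s"])
      fix s assume "s = l / 2"
      then show "- P s + \<epsilon> * \<eta> s = P s + \<epsilon> * \<eta> s" by (simp only: half(1))
    qed (intro continuous_intros continuous_P cont\<eta>)+
    fix x assume x: "x \<in> {0<..<l} - {l / 2}"
    show "(w has_real_derivative h x) (at x)"
    proof (cases "x < l / 2")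
      case True
      have "(w has_real_derivative c * sin (X x) + \<epsilon> * \<eta>' x) (at x)"
        by (rule has_field_derivative_transform_within_open[OF dw1, where S = "{..<l / 2}"])
          (use True in \<open>auto simp: w_def\<close>)
      then show ?thesis using True by (simp add: h_def)
    next
      case False
      then have "x > l / 2" using x by auto
      have "(w has_real_derivative - c * sin (X x) + \<epsilon> * \<eta>' x) (at x)"
        by (rule has_field_derivative_transform_within_open[OF dw2, where S = "{l / 2<..}"])
          (use \<open>x > l / 2\<close> in \<open>auto simp: w_def\<close>)
      then show ?thesis using \<open>x > l / 2\<close> by (simp add: h_def)
    qed
  next
    have [measurable]: "X \<in> borel_measurable borel" "P \<in> borel_measurable borel"
      by (intro borel_measurable_continuous_onI continuous_X continuous_P)+
    have "h \<in> borel_measurable borel"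
      unfolding h_def \<eta>'_def by measurable
    then show "set_borel_measurable lborel {0..l} h"
      unfolding set_borel_measurable_def by simp
    fix x
    have "\<bar>P x\<bar> \<le> 2"
    proof -
      have "(P x)\<^sup>2 \<le> 4" using P_square[of x] k zero_le_power2[of "sin (X x / 2)"] by linarith
      then show ?thesis using abs_le_square_iff[of "P x" 2] by simp
    qed
    then have "\<bar>\<epsilon> * \<eta>' x\<bar> \<le> \<epsilon> * (c * 2)"
      unfolding \<eta>'_def using c \<epsilon> by (simp add: abs_mult)
    moreover have "\<bar>c * sin (X x)\<bar> \<le> c" using c by (simp add: abs_mult)
    ultimately show "\<bar>h x\<bar> \<le> c + \<epsilon> * (c * 2)"
      unfolding h_def by auto
  qed simp
  define f where "f = (\<lambda>s. quad w h s - \<epsilon>\<^sup>2 * quad \<eta> \<eta>' s)"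
  \<comment> \<open>With \<open>\<sigma>\<close> the sign in front of \<open>P\<close>,
    \<open>F \<sigma>\<close> is a primitive of the second variation integrand on one half of
    \<open>[0, l]\<close>, apart from the part quadratic in \<open>\<eta>\<close>.\<close>
  define F where "F = (\<lambda>\<sigma> s. - P s * sin (X s) - 2 * \<sigma> * \<epsilon> * (sin (X s) * \<eta> s))"
  have dF: "(F \<sigma> has_real_derivative (\<sigma> * (- c * sin (X s)) + \<epsilon> * \<eta>' s)\<^sup>2 / c - c * cos (X s) * (\<sigma> * P s + \<epsilon> * \<eta> s)\<^sup>2
      - \<epsilon>\<^sup>2 * quad \<eta> \<eta>' s) (at s)" if "\<sigma> * \<sigma> = 1" for \<sigma> s
  proof -
    have "(F \<sigma> has_real_derivative - (- c * sin (X s) * sin (X s) + cos (X s) * (c * P s) * P s)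
        - 2 * \<sigma> * \<epsilon> * (cos (X s) * (c * P s) * \<eta> s + \<eta>' s * sin (X s))) (at s)"
      unfolding F_def by (auto intro!: derivative_eq_intros dX dP d\<eta>)
    moreover have "(\<sigma> * (- c * y) + \<epsilon> * e')\<^sup>2 / c - c * x * (\<sigma> * p + \<epsilon> * e)\<^sup>2 - \<epsilon>\<^sup>2 * (e'\<^sup>2 / c - c * x * e\<^sup>2) =
        - (- c * y * y + x * (c * p) * p) - 2 * \<sigma> * \<epsilon> * (x * (c * p) * e + e' * y)" for x y e e' p
    proof -
      have "(\<sigma> * (- c * y) + \<epsilon> * e')\<^sup>2 / c = \<sigma> * \<sigma> * c * y * y - 2 * \<sigma> * \<epsilon> * y * e' + \<epsilon>\<^sup>2 * (e'\<^sup>2 / c)"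
        using c by (simp add: field_simps power2_eq_square)
      moreover have "c * x * (\<sigma> * p + \<epsilon> * e)\<^sup>2 = \<sigma> * \<sigma> * (c * x * p * p) + 2 * \<sigma> * \<epsilon> * (c * x * p * e) + \<epsilon>\<^sup>2 * (c * x * e\<^sup>2)"
        by (simp add: algebra_simps power2_eq_square)
      ultimately show ?thesis unfolding that by (simp add: algebra_simps)
    qed
    ultimately show ?thesis unfolding quad_def by (simp only:)
  qed
  have contF: "continuous_on A (F \<sigma>)" for A \<sigma>
    unfolding F_def by (intro continuous_intros continuous_P continuous_X cont\<eta>)
  have "(f has_integral F (-1) (l / 2) - F (-1) 0) {0..l / 2}"
  proof (rule fundamental_theorem_of_calculus_interior)
    fix s assume "s \<in> {0<..<l / 2}"
    then have "f s = ((- 1) * (- c * sin (X s)) + \<epsilon> * \<eta>' s)\<^sup>2 / c - c * cos (X s) * ((- 1) * P s + \<epsilon> * \<eta> s)\<^sup>2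
      - \<epsilon>\<^sup>2 * quad \<eta> \<eta>' s"
      unfolding f_def w_def h_def quad_def by simp
    then show "(F (-1) has_vector_derivative f s) (at s)"
      using dF[of "-1" s] by (simp only: has_real_derivative_iff_has_vector_derivative[symmetric])
  qed (use l contF in auto)
  moreover have "(f has_integral F 1 l - F 1 (l / 2)) {l / 2..l}"
  proof (rule fundamental_theorem_of_calculus_interior)
    fix s assume "s \<in> {l / 2<..<l}"
    then have "f s = (1 * (- c * sin (X s)) + \<epsilon> * \<eta>' s)\<^sup>2 / c - c * cos (X s) * (1 * P s + \<epsilon> * \<eta> s)\<^sup>2
      - \<epsilon>\<^sup>2 * quad \<eta> \<eta>' s"
      unfolding f_def w_def h_def quad_def by simp
    then show "(F 1 has_vector_derivative f s) (at s)"
      using dF[of 1 s] by (simp only: has_real_derivative_iff_has_vector_derivative[symmetric])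
  qed (use l contF in auto)
  ultimately have "(f has_integral (F (-1) (l / 2) - F (-1) 0) + (F 1 l - F 1 (l / 2))) {0..l}"
    by (rule has_integral_combine[rotated 2]) (use l in auto)
  \<comment> \<open>\<open>F\<close> is 0 at 0 and at \<open>l\<close>. At \<open>l / 2\<close> the
    two signs give \<open>- 4\<close> and \<open>4\<close> times
    \<open>\<epsilon> * X 0 * sin (X 0)\<close>, so the corner alone contributes.\<close>
  moreover have "(F (-1) (l / 2) - F (-1) 0) + (F 1 l - F 1 (l / 2)) = - 8 * \<epsilon> * (X 0 * sin (X 0))"
    unfolding F_def \<eta>_def using half P_ends X_l by (simp add: algebra_simps)
  ultimately have int_f: "(f has_integral - 8 * \<epsilon> * (X 0 * sin (X 0))) {0..l}" by simp
  have iw: "set_integrable lborel {0..l} (quad w h)" by (rule quad_set_integrable[OF wh])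
  have i\<eta>: "set_integrable lborel {0..l} (\<lambda>s. \<epsilon>\<^sup>2 * quad \<eta> \<eta>' s)"
    using quad_set_integrable[OF w\<eta>] by (rule set_integrable_mult_right)
  have if': "set_integrable lborel {0..l} f"
    unfolding f_def by (rule set_integral_diff(1)[OF iw i\<eta>])
  have "(LBINT s:{0..l}. quad w h s) - \<epsilon>\<^sup>2 * R = (LBINT s:{0..l}. f s)"
    unfolding f_def R_def set_integral_diff(2)[OF iw i\<eta>] set_integral_mult_right ..
  also have "\<dots> = - 8 * \<epsilon> * (X 0 * sin (X 0))"
    using set_borel_integral_eq_integral(2)[OF if'] int_f by (simp add: integral_unique)
  finally have "(LBINT s:{0..l}. quad w h s) = \<epsilon> * (\<epsilon> * R - 8 * (X 0 * sin (X 0)))"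
    by (simp add: algebra_simps power2_eq_square)
  also have "\<dots> < 0" using \<epsilon> \<epsilon>R by (intro mult_pos_neg) auto
  finally have neg: "(LBINT s:{0..l}. quad w h s) < 0" .
  define w0 where "w0 = (\<lambda>s. if s \<in> {0..l} then w s else 0)"
  have w0: "has_weak_deriv 0 l w0 h"
    by (rule has_weak_deriv_cong[OF wh]) (simp add: w0_def)
  have "w0 \<in> H1_dirichlet l"
    unfolding H1_dirichlet_def H1_def using w0 l P_ends X_l
    by (auto simp: w0_def w_def \<eta>_def)
  moreover have "(LBINT s:{0..l}. quad w0 h s) = (LBINT s:{0..l}. quad w h s)"
    by (rule set_lebesgue_integral_cong) (auto simp: quad_def w0_def)
  ultimately show thesis using that w0 neg by simp
qed

lemma morse_index_action_dirichlet:
  assumes c1: "c = 1"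
  shows "morse_index (H1_dirichlet l) (second_differential (action l) X) = 1"
proof (rule antisym)
  have "morse_index (H1_dirichlet l) (second_differential (action l) X) \<le> enat DIM(real)"
  proof (rule morse_index_le_DIM[OF linear_evaluation_sum[of "l / 4" "3 * l / 4"]])
    fix v :: "real \<Rightarrow> real"
    assume v: "v \<in> H1_dirichlet l" "v (l / 4) + v (3 * l / 4) = 0"
    then obtain g where g: "has_weak_deriv 0 l v g" unfolding H1_dirichlet_def H1_def by auto
    have "(LBINT s:{0..l}. quad v g s) \<ge> 0"
      \<comment> \<open>Equality of the end values holds because both are 0.\<close>
      by (rule quad_nonneg[OF g _ v(2)]) (use v(1) in \<open>simp add: H1_dirichlet_def\<close>)
    then show "0 \<le> second_differential (action l) X v v"
      by (simp add: second_differential_action[OF g c1])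
  qed
  then show "morse_index (H1_dirichlet l) (second_differential (action l) X) \<le> 1"
    by (simp add: one_enat_def)
  obtain w h where w: "has_weak_deriv 0 l w h" "w \<in> H1_dirichlet l"
    and neg: "(LBINT s:{0..l}. quad w h s) < 0"
    by (rule dirichlet_direction)
  show "1 \<le> morse_index (H1_dirichlet l) (second_differential (action l) X)"
  proof (rule morse_index_ge_1[where v = w])
    fix a :: real assume a: "a \<noteq> 0"
    have "quad (a *\<^sub>R w) (\<lambda>s. a * h s) = (\<lambda>s. a\<^sup>2 * quad w h s)"
      unfolding quad_def by (rule ext) (simp add: scaleR_fun_def algebra_simps power_mult_distrib)
    then have "second_differential (action l) X (a *\<^sub>R w) (a *\<^sub>R w) = a\<^sup>2 * (LBINT s:{0..l}. quad w h s)"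
      unfolding second_differential_action[OF has_weak_deriv_scaleR[OF w(1)] c1]
      by (simp only: set_integral_mult_right)
    then show "second_differential (action l) X (a *\<^sub>R w) (a *\<^sub>R w) < 0"
      using neg a by (simp add: mult_pos_neg)
  qed (rule subspace_H1_dirichlet w(2) second_differential_zero)+
qed

end

section \<open>The period of the pendulum\<close>

lemma abs_sin_diff_le: "\<bar>sin x - sin y\<bar> \<le> \<bar>x - y\<bar>" for x y :: real
proof -
  have "norm (sin x - sin y) \<le> 1 * norm (x - y)"
    by (rule field_differentiable_bound[of UNIV _ cos]) (auto intro!: derivative_eq_intros)
  then show ?thesis by simp
qed

definition pendulum_solution :: "(real \<Rightarrow> real) \<Rightarrow> (real \<Rightarrow> real) \<Rightarrow> bool"
  where "pendulum_solution p q \<longleftrightarrow>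
    (\<forall>t. (p has_real_derivative - sin (q t)) (at t)) \<and> (\<forall>t. (q has_real_derivative p t) (at t))"

text \<open>A Gronwall argument: the squared distance of two solutions, weighted by
  \<open>exp (- 2 * t)\<close>, does not increase since the sine is 1-Lipschitz. It works forward in
  time; reflections cover the past.\<close>

lemma pendulum_solution_unique:
  assumes 1: "pendulum_solution p q" and 2: "pendulum_solution p' q'"
    and eq: "p a = p' a" "q a = q' a" and t: "a \<le> t"
  shows "p t = p' t" "q t = q' t"
proof -
  define W where "W = (\<lambda>t. ((p t - p' t)\<^sup>2 + (q t - q' t)\<^sup>2) * exp (- 2 * t))"
  have d: "(p has_real_derivative - sin (q t)) (at t)" "(q has_real_derivative p t) (at t)"
    "(p' has_real_derivative - sin (q' t)) (at t)" "(q' has_real_derivative p' t) (at t)" for t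
    using 1 2 unfolding pendulum_solution_def by auto
  have "W t \<le> W a"
  proof (rule DERIV_nonpos_imp_nonincreasing[OF t])
    fix x
    define u where "u = p x - p' x"
    define v where "v = q x - q' x"
    define s where "s = sin (q x) - sin (q' x)"
    have "(W has_real_derivative (2 * u * (- s) + 2 * v * u - 2 * (u\<^sup>2 + v\<^sup>2)) * exp (- 2 * x)) (at x)"
      unfolding W_def u_def v_def s_def by (auto intro!: derivative_eq_intros d simp: algebra_simps)
    moreover have "2 * u * (- s) + 2 * v * u - 2 * (u\<^sup>2 + v\<^sup>2) \<le> 0"
    proof -
      have "\<bar>s\<bar> \<le> \<bar>v\<bar>" unfolding s_def v_def by (rule abs_sin_diff_le)
      then have "\<bar>u\<bar> * \<bar>s\<bar> \<le> \<bar>u\<bar> * \<bar>v\<bar>" by (rule mult_left_mono) simp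
      moreover have "2 * (\<bar>u\<bar> * \<bar>v\<bar>) \<le> u\<^sup>2 + v\<^sup>2"
        using sum_squares_bound[of "\<bar>u\<bar>" "\<bar>v\<bar>"] by simp
      moreover have "- (u * s) \<le> \<bar>u\<bar> * \<bar>s\<bar>" "v * u \<le> \<bar>u\<bar> * \<bar>v\<bar>"
        by (simp_all add: abs_mult[symmetric] mult.commute)
      ultimately show ?thesis by simp
    qed
    ultimately show "\<exists>y. (W has_real_derivative y) (at x) \<and> y \<le> 0"
      by (intro exI conjI) (auto intro: mult_nonpos_nonneg)
  qed
  then have "((p t - p' t)\<^sup>2 + (q t - q' t)\<^sup>2) * exp (- 2 * t) \<le> 0"
    unfolding W_def using eq by simp
  then have "(p t - p' t)\<^sup>2 + (q t - q' t)\<^sup>2 \<le> 0"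
    by (simp add: mult_le_0_iff)
  then have "(p t - p' t)\<^sup>2 + (q t - q' t)\<^sup>2 = 0"
    by (meson add_nonneg_nonneg antisym zero_le_power2)
  then show "p t = p' t" "q t = q' t" by (simp_all add: sum_power2_eq_zero_iff)
qed

text \<open>Two reversing symmetries: the first fixes states with \<open>p = 0\<close>, the second
  states with \<open>q = 0\<close>. Combined with uniqueness they give reflections of the orbit
  about turning points and about zeros of \<open>q\<close>.\<close>

lemma pendulum_solution_reverse:
  assumes "pendulum_solution p q"
  shows "pendulum_solution (\<lambda>t. - p (b - t)) (\<lambda>t. q (b - t))"
    and "pendulum_solution (\<lambda>t. p (b - t)) (\<lambda>t. - q (b - t))"
proof -
  have d: "(p has_real_derivative - sin (q t)) (at t)" "(q has_real_derivative p t) (at t)" for t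
    using assms unfolding pendulum_solution_def by auto
  have b: "((\<lambda>t. b - t) has_real_derivative - 1) (at t)" for t
    by (auto intro!: derivative_eq_intros)
  show "pendulum_solution (\<lambda>t. - p (b - t)) (\<lambda>t. q (b - t))"
    "pendulum_solution (\<lambda>t. p (b - t)) (\<lambda>t. - q (b - t))"
    unfolding pendulum_solution_def
    using DERIV_chain2[OF d(1) b] DERIV_chain2[OF d(2) b] by (auto intro!: derivative_eq_intros)
qed

text \<open>If \<open>t0\<close> is the first zero of \<open>q\<close>, reflection about 0 and about
  \<open>t0\<close> determines the orbit from its arc over \<open>[0, t0]\<close>, and the minimal
  period is \<open>4 * t0\<close>.\<close>

lemma librational_orbit_scaled_libration:
  assumes k: "0 < k" "k < 2" and orbit: "librational_orbit k p q"
    and T: "minimal_period (\<lambda>t. (p t, q t)) T"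
  shows "scaled_libration 1 T k q p"
proof -
  define a where "a = arccos (1 - k)"
  have a: "0 < a" "a < pi" using arccos_lt_bounded[of "1 - k"] k unfolding a_def by auto
  have dp: "(p has_real_derivative - sin (q t)) (at t)" and dq: "(q has_real_derivative p t) (at t)"
    and energy: "(p t)\<^sup>2 / 2 + (1 - cos (q t)) = k" for t
    using orbit unfolding librational_orbit_def pendulum_H_def by auto
  have init: "p 0 = 0" "q 0 = a" using orbit unfolding librational_orbit_def a_def by auto
  have sol: "pendulum_solution p q" unfolding pendulum_solution_def using dp dq by blast
  have cq: "continuous_on A q" for A
    by (rule DERIV_continuous_on, rule has_field_derivative_at_within, rule dq)
  have even: "q (- t) = q t" "p (- t) = - p t" for t
  proof -
    have *: "q (- t) = q t \<and> p (- t) = - p t" if "0 \<le> t" for t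
    proof -
      have "p t = - p (0 - t)" "q t = q (0 - t)"
        by (rule pendulum_solution_unique[OF sol pendulum_solution_reverse(1)[OF sol, of 0] _ _ that];
            simp add: init)+
      then show ?thesis unfolding diff_0 by linarith
    qed
    have "q (- t) = q t \<and> p (- t) = - p t"
    proof (cases "0 \<le> t")
      case False
      then show ?thesis using *[of "- t"] unfolding minus_minus by linarith
    qed (rule *)
    then show "q (- t) = q t" "p (- t) = - p t" by blast+
  qed
  \<comment> \<open>Reaching \<open>pi\<close> would need energy at least 2, which exceeds
    \<open>k\<close>.\<close>
  have lt_pi: "q t < pi" for t
  proof (rule ccontr)
    assume "\<not> q t < pi"
    then have "pi \<le> q \<bar>t\<bar>" using even(1)[of t] by (cases "0 \<le> t") auto
    then obtain s where "q s = pi"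
      using IVT'[of q 0 pi "\<bar>t\<bar>"] init a cq by auto
    then show False using energy[of s] k zero_le_power2[of "p s"] by simp
  qed
  \<comment> \<open>Otherwise \<open>q\<close> stays in \<open>(0, pi)\<close>, so \<open>p\<close>
    is strictly decreasing, and after time 1 the graph of \<open>q\<close> lies below a line of
    slope \<open>p 1 < 0\<close>.\<close>
  have "\<exists>t\<ge>0. q t = 0"
  proof (rule ccontr)
    assume none: "\<not> (\<exists>t\<ge>0. q t = 0)"
    have pos: "q t > 0" if t: "t \<ge> 0" for t
    proof (rule ccontr)
      assume "\<not> q t > 0"
      then obtain s where "0 \<le> s" "q s = 0"
        using IVT2'[of q t 0 0] init a cq t by auto
      then show False using none by blast
    qed
    have dec: "p t < p s" if "0 \<le> s" "s < t" for s t
      by (rule DERIV_neg_imp_decreasing[OF that(2)])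
        (use that dp pos lt_pi in \<open>force intro!: exI sin_gt_zero\<close>)
    have p1: "p 1 < 0" using dec[of 0 1] init by simp
    \<comment> \<open>The time at which the tangent to \<open>q\<close> at 1 reaches 0.\<close>
    define t where "t = 1 - q 1 / p 1"
    have t: "1 < t" unfolding t_def using p1 pos[of 1] by (simp add: divide_pos_neg)
    obtain z where z: "1 < z" "z < t" "q t - q 1 = (t - 1) * p z"
      using MVT2[OF t, of q p] dq by auto
    have "(t - 1) * p z \<le> (t - 1) * p 1"
      using dec[of 1 z] z t by (intro mult_left_mono) auto
    also have "(t - 1) * p 1 = - q 1" unfolding t_def using p1 by simp
    finally have "q t \<le> 0" using z(3) by simp
    then show False using pos[of t] t by simp
  qed
  then obtain t1 where t1: "t1 \<ge> 0" "q t1 = 0" by blast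
  \<comment> \<open>The infimum of this closed set is the first zero of \<open>q\<close>.\<close>
  define A where "A = {t \<in> {0..t1}. q t = 0}"
  have "closed A"
    unfolding A_def using continuous_closed_preimage_constant[OF cq, of "{0..t1}" 0] by simp
  moreover have "A \<noteq> {}" "bdd_below A" unfolding A_def using t1 by auto
  ultimately have InfA: "Inf A \<in> A" by (intro closed_contains_Inf)
  define t0 where "t0 = Inf A"
  have qt0: "q t0 = 0" and "t0 \<ge> 0" "t0 \<le> t1" using InfA unfolding t0_def A_def by auto
  then have t0: "t0 > 0" using init a by (cases "t0 = 0") auto
  have qpos: "q t > 0" if t: "0 \<le> t" "t < t0" for t
  proof (rule ccontr)
    assume "\<not> q t > 0"
    then obtain s where s: "0 \<le> s" "s \<le> t" "q s = 0"
      using IVT2'[of q t 0 0] init a cq t by auto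
    then have "s \<in> A" unfolding A_def using t \<open>t0 \<le> t1\<close> by auto
    then have "t0 \<le> s" unfolding t0_def using \<open>bdd_below A\<close> by (rule cInf_lower)
    then show False using s t by simp
  qed
  have pneg1: "p t < 0" if t: "0 < t" "t \<le> t0" for t
  proof -
    have "p t < p 0"
    proof (rule DERIV_neg_imp_decreasing_open[OF t(1)])
      fix x assume x: "0 < x" "x < t"
      then have "sin (q x) > 0" using qpos[of x] lt_pi[of x] t by (intro sin_gt_zero) auto
      then show "\<exists>y. (p has_real_derivative y) (at x) \<and> y < 0" using dp[of x] by (intro exI[of _ "- sin (q x)"]) auto
    qed (rule DERIV_continuous_on, rule has_field_derivative_at_within, rule dp)
    then show ?thesis using init by simp
  qed
  have refl: "q (2 * t0 - t) = - q t" "p (2 * t0 - t) = p t" for t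
  proof -
    have *: "q (2 * t0 - t) = - q t \<and> p (2 * t0 - t) = p t" if "t0 \<le> t" for t
    proof -
      have "p t = p (2 * t0 - t)" "q t = - q (2 * t0 - t)"
        by (rule pendulum_solution_unique[OF sol pendulum_solution_reverse(2)[OF sol, of "2 * t0"] _ _ that];
            simp add: qt0)+
      then show ?thesis by linarith
    qed
    have "q (2 * t0 - t) = - q t \<and> p (2 * t0 - t) = p t"
    proof (cases "t0 \<le> t")
      case False
      moreover have "2 * t0 - (2 * t0 - t) = t" by simp
      ultimately show ?thesis using *[of "2 * t0 - t"] by auto
    qed (rule *)
    then show "q (2 * t0 - t) = - q t" "p (2 * t0 - t) = p t" by blast+
  qed
  \<comment> \<open>The composition of the two reflections is translation by \<open>2 * t0\<close>
    with a change of sign.\<close>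
  have half: "q (t + 2 * t0) = - q t" "p (t + 2 * t0) = - p t" for t
    using refl[of "- t"] even[of t] by (simp_all add: add.commute)
  have pneg: "p t < 0" if t: "0 < t" "t < 2 * t0" for t
    using pneg1[of t] pneg1[of "2 * t0 - t"] refl(2)[of t] t by (cases "t \<le> t0") auto
  have per: "q (t + 4 * t0) = q t" "p (t + 4 * t0) = p t" for t
    using half[of "t + 2 * t0"] half[of t] by (simp_all add: algebra_simps)
  have T': "T > 0" "\<And>t. p (t + T) = p t" "\<And>t. q (t + T) = q t"
    "\<And>S. 0 < S \<Longrightarrow> S < T \<Longrightarrow> \<not> (\<forall>t. p (t + S) = p t \<and> q (t + S) = q t)"
    using T unfolding minimal_period_def by auto
  \<comment> \<open>A shorter period would be a time in \<open>(0, 4 * t0)\<close> with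
    \<open>p = 0\<close> and \<open>q = a\<close>. But \<open>p\<close> vanishes there only at
    \<open>2 * t0\<close>, where \<open>q = - a\<close>.\<close>
  have TT: "T = 4 * t0"
  proof (rule ccontr)
    assume ne: "T \<noteq> 4 * t0"
    have "\<not> 4 * t0 < T" using T'(4)[of "4 * t0"] per t0 by auto
    then have lt: "T < 4 * t0" using ne by simp
    have pT: "p T = 0" and qT: "q T = a" using T'(2,3)[of 0] init by auto
    consider "T < 2 * t0" | "T = 2 * t0" | "2 * t0 < T" by linarith
    then show False
    proof cases
      case 1 then show False using pneg[of T] T'(1) pT by simp
    next
      case 2 then show False using half(1)[of 0] init a qT by simp
    next
      case 3 then show False using pneg[of "T - 2 * t0"] half(2)[of "T - 2 * t0"] lt pT by simp
    qed
  qed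
  have gt_pi: "- pi < q t" for t
    using half(1)[of t] lt_pi[of "t + 2 * t0"] by simp
  have q_nz1: "q t \<noteq> 0" if "0 \<le> t" "t \<le> 2 * t0" "t \<noteq> t0" for t
    using qpos[of t] qpos[of "2 * t0 - t"] refl(1)[of t] that by (cases "t < t0") auto
  have q_nz: "q t \<noteq> 0" if "0 \<le> t" "t \<le> 4 * t0" "t \<noteq> t0" "t \<noteq> 3 * t0" for t
    using q_nz1[of t] q_nz1[of "t - 2 * t0"] half(1)[of "t - 2 * t0"] that by (cases "t \<le> 2 * t0") auto
  show ?thesis
  proof
    show "sin (q s / 2) \<noteq> 0" if "0 \<le> s" "s \<le> T" "s \<noteq> T / 4" "s \<noteq> 3 * T / 4" for s
    proof -
      have "q s \<noteq> 0" using q_nz[of s] that TT by auto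
      then show ?thesis
        using sin_gt_zero[of "q s / 2"] sin_gt_zero[of "- q s / 2"] lt_pi[of s] gt_pi[of s]
        by (cases "q s > 0") auto
    qed
    show "q (T / 4) = 0" using qt0 TT by simp
    show "q (3 * T / 4) = 0" "p (3 * T / 4) = - p (T / 4)"
      using half[of t0] qt0 TT by (simp_all add: algebra_simps)
    show "p (T / 2) = 0" "q (T / 2) = - q 0" using half[of 0] init TT by simp_all
    show "p T = 0" using T'(2)[of 0] init by simp
  qed (use k T' a init dp dq energy in auto)
qed

text \<open>Passing to the parameter \<open>s = t / T\<close> turns the period into the time scale,
  the form in which the orbit enters the free-period functional.\<close>

lemma scaled_libration_unit_interval:
  assumes "scaled_libration 1 T k q p"
  shows "scaled_libration T 1 k (\<lambda>s. q (T * s)) (\<lambda>s. p (T * s))"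
proof -
  interpret scaled_libration 1 T k q p by fact
  have d: "((\<lambda>s. T * s) has_real_derivative T) (at s)" for s
    by (auto intro!: derivative_eq_intros)
  show ?thesis
  proof
    show "((\<lambda>s. q (T * s)) has_real_derivative T * p (T * s)) (at s)" for s
      by (rule DERIV_cong[OF DERIV_chain2[OF dX d]]) simp
    show "((\<lambda>s. p (T * s)) has_real_derivative - T * sin (q (T * s))) (at s)" for s
      by (rule DERIV_cong[OF DERIV_chain2[OF dP d]]) simp
    show "q (T * (s + 1)) = q (T * s)" for s using periodic[of "T * s"] by (simp add: algebra_simps)
    show "sin (q (T * s) / 2) \<noteq> 0" if "0 \<le> s" "s \<le> 1" "s \<noteq> 1 / 4" "s \<noteq> 3 * 1 / 4" for s
      by (rule sin_half_nonzero) (use that l in auto)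
    show "q (T * (3 * 1 / 4)) = 0" "p (T * (3 * 1 / 4)) = - p (T * (1 / 4))"
      using X_zeros by (simp_all add: algebra_simps)
  qed (use l k energy P_ends half X_0 X_zeros in auto)
qed

theorem theorem5p4:
  fixes k T :: real and p q :: "real \<Rightarrow> real"
  assumes "0 < k" and "k < 2"
    and "librational_orbit k p q"
    and "minimal_period (\<lambda>t. (p t, q t)) T"
  shows "index_periodic T q = 1 \<and>
    index_free k T q = 2 \<and>
    index_dirichlet T q = 1 \<and>
    \<not> local_minimizer (H1_norm T) (H1_periodic T) (action T) q \<and>
    \<not> local_minimizer (\<lambda>(\<xi>, \<tau>). sqrt ((H1_norm 1 \<xi>)\<^sup>2 + \<tau>\<^sup>2)) (H1_periodic 1 \<times> {0<..})
        (free_action k) (\<lambda>s. q (T * s), T)"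
proof -
  have "scaled_libration 1 T k q p"
    by (rule librational_orbit_scaled_libration[OF assms])
  then interpret fixed: scaled_libration 1 T k q p .
  interpret free: scaled_libration T 1 k "\<lambda>s. q (T * s)" "\<lambda>s. p (T * s)"
    by (rule scaled_libration_unit_interval) (rule fixed.scaled_libration_axioms)
  show ?thesis
    unfolding index_periodic_def index_free_def index_dirichlet_def free_action_eq
    using fixed.morse_index_action_periodic fixed.morse_index_action_dirichlet
      fixed.not_local_minimizer_action free.morse_index_free_time_action
      free.not_local_minimizer_free_time_action by simp
qed

end
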